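(* Let $\{\Delta^\circ_v\},\{\Delta^\bullet_w\}$ be a dual $n$-dimer. There exists a choice of surgery data $\mathcal D$ making the dimer Lagrangian $L^{\mathcal D}(\phi^\bullet_w,\phi^\circ_v)\subset(\mathbb C^* )^n$ exact.
   Context: Dual $n$-dimer: two finite collections of $n$-polytopes $\{\Delta^\circ_v\},\{\Delta^\bullet_w\}$ in $\mathbb R^n$ such that (i) within each colour, vertices congruent mod $\mathbb Z^n$ are equal; (ii) the vertex sets of the two colours agree mod $\mathbb Z^n$; (iii) if a vertex $p_1$ of $\Delta^\circ_{v_1}$ corresponds to a vertex $p_2\equiv p_1$ of $\Delta^\bullet_{v_2}$ and the edges of $\Delta^\circ_{v_1}$ at $p_1$ point in directions $e_1,\dots,e_k$, then the edges of $\Delta^\bullet_{v_2}$ at $p_2$ point in directions $-e_1,\dots,-e_k$. The bipartite graph $G\subset T^n=\mathbb R^n/\mathbb Z^n$ has one vertex per polytope and one edge for each vertex shared mod $\mathbb Z^n$ by a $\bullet$ and a $\circ$ polytope. Identify $(\mathbb C^* )^n=T^*Q/T^*_{\mathbb Z}Q$, $Q=\mathbb R^n$, with coordinates $(q,p)$, and set $\eta=q\cdot dp$. A Lagrangian is exact if $\eta$ restricted to it is exact. Let $\phi^\circ_v(q)=\max_{p\in\Delta^\circ_v}\langle p,q\rangle$ and $\phi^\bullet_w(q)=\min_{p\in\Delta^\bullet_w}\langle p,q\rangle$. Given a smoothing kernel $\rho$ supported in a ball of radius $R$, let $\tilde\phi_\rho$ be the convolution of $\phi$ with $\rho$, shifted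 by a constant so that $\tilde\phi_\rho(0)=0$, and let $\sigma$ be the image in $(\mathbb C^* )^n$ of the graph of $d\tilde\phi_\rho$. For an edge $e$ of $G$ given by a common vertex $\beta$ of $\Delta^\bullet_w$ and $\Delta^\circ_v$, $\sigma^\bullet_w$ and $\sigma^\circ_v$ coincide over $U_e=\{q: B_R(q)\subset \underline U_\beta\}$, where $\underline U_\beta$ is the cone on which both functions are linear with slope $\beta$ (mod $\mathbb Z^n$). Surgery along $U_e$: near $U_e$, up to an integral linear function and a constant, $f_e=\tilde\phi^\circ_v-\tilde\phi^\bullet_w$ is a nonnegative convex function vanishing exactly on $U_e$. A pair of profile functions $r_e,s_e:\mathbb R_{>\epsilon_e/2}\to\mathbb R$ satisfies $r_e'=1$, $s_e'=0$ for $t\ge\epsilon_e$, and the curves $(t,r_e'(t))$ and $(t,s_e'(t))$ together close up at $t=\epsilon_e/2$ to a smooth plane curve. Near $U_e$, the union $\sigma^\bullet_w\cup\sigma^\circ_v$ is replaced by the closure of the union of the graphs of $d(\tilde\phi^\bullet_w+s_e\circ f_e)$ and $d(\tilde\phi^\bullet_w+r_e\circ f_e)$ over $\{f_e>\epsilon_e/2\}$. The surgery data are $\mathcal D=\{\rho,\{r_e,s_e\}_{e\in E(G)}\}$, and $L^{\mathcal D}(\phi^\bullet_w,\phi^\circ_v)$ is the Lagrangian obtained from all the sections $\sigma^\circ_v,\sigma^\bullet_w$ by performing these surgeries at all edges $e$. *)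

theory Defs
  imports "HOL-Analysis.Analysis"
begin

section \<open>Dual dimers\<close>

definition lattice_points :: "(real^'n) set" where
  "lattice_points = {m. \<forall>i. m $ i \<in> \<int>}"

definition full_polytope :: "(real^'n) set \<Rightarrow> bool" where
  "full_polytope \<Delta> \<longleftrightarrow> polytope \<Delta> \<and> aff_dim \<Delta> = int CARD('n)"

definition edge_directions :: "(real^'n) set \<Rightarrow> real^'n \<Rightarrow> (real^'n) set" where
  "edge_directions \<Delta> p = {sgn (x - p) | x E. E edge_of \<Delta> \<and> p \<in> E \<and> x \<in> E \<and> x \<noteq> p}"

text \<open>A vertex of a collection is a polytope together with one of its vertices: besides asking that
  congruent vertices are the same point, \<open>separated_vertices\<close> asks that they are vertices of the same
  polytope. Without this two edges of the dimer graph could ask for surgery on the same part of one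
  section.\<close>

definition separated_vertices :: "(real^'n) set set \<Rightarrow> bool" where
  "separated_vertices C \<longleftrightarrow>
     (\<forall>\<Delta>1\<in>C. \<forall>\<Delta>2\<in>C. \<forall>p1 p2. p1 extreme_point_of \<Delta>1 \<and> p2 extreme_point_of \<Delta>2 \<and>
        p1 - p2 \<in> lattice_points \<longrightarrow> (\<Delta>1, p1) = (\<Delta>2, p2))"

definition vertices_mod :: "(real^'n) set set \<Rightarrow> (real^'n) set" where
  "vertices_mod C = {p + m | p m \<Delta>. \<Delta> \<in> C \<and> p extreme_point_of \<Delta> \<and> m \<in> lattice_points}"

text \<open>\<open>B\<close> is the black (\<open>\<bullet>\<close>) and \<open>W\<close> the white (\<open>\<circ>\<close>) collection.\<close>

definition dual_dimer :: "(real^'n) set set \<Rightarrow> (real^'n) set set \<Rightarrow> bool" where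
  "dual_dimer B W \<longleftrightarrow>
     finite B \<and> finite W \<and> (\<forall>\<Delta>\<in>B \<union> W. full_polytope \<Delta>) \<and>
     separated_vertices B \<and> separated_vertices W \<and>
     vertices_mod B = vertices_mod W \<and>
     (\<forall>\<Delta>w\<in>W. \<forall>\<Delta>b\<in>B. \<forall>p1 p2. p1 extreme_point_of \<Delta>w \<and> p2 extreme_point_of \<Delta>b \<and>
        p1 - p2 \<in> lattice_points \<longrightarrow>
        edge_directions \<Delta>b p2 = uminus ` edge_directions \<Delta>w p1)"

text \<open>An edge of the dimer graph records its black and white polytope and the common vertex, seen as
  a vertex of either polytope; the two representatives may differ by an element of the lattice.\<close>

record ('n::finite) dimer_edge =
  black :: "(real^'n) set"
  white :: "(real^'n) set"
  bvert :: "real^'n"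
  wvert :: "real^'n"

definition dimer_edges :: "(real^'n) set set \<Rightarrow> (real^'n) set set \<Rightarrow> 'n dimer_edge set" where
  "dimer_edges B W = {e. black e \<in> B \<and> white e \<in> W \<and>
     bvert e extreme_point_of black e \<and> wvert e extreme_point_of white e \<and>
     wvert e - bvert e \<in> lattice_points}"


section \<open>Smooth functions and mollified support functions\<close>

text \<open>For open \<open>S\<close>: \<open>C_on k\<close> is the class of \<open>C\<^sup>k\<close> functions.\<close>

primrec C_on :: "nat \<Rightarrow> ('a::euclidean_space \<Rightarrow> real) \<Rightarrow> 'a set \<Rightarrow> bool" where
  "C_on 0 f S \<longleftrightarrow> continuous_on S f"
| "C_on (Suc k) f S \<longleftrightarrow> f differentiable_on S \<and>
     (\<forall>b\<in>Basis. C_on k (\<lambda>x. frechet_derivative f (at x) b) S)"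

definition smooth_on :: "('a::euclidean_space \<Rightarrow> real) \<Rightarrow> 'a set \<Rightarrow> bool" where
  "smooth_on f S \<longleftrightarrow> (\<forall>k. C_on k f S)"

definition grad :: "('a::euclidean_space \<Rightarrow> real) \<Rightarrow> 'a \<Rightarrow> 'a" where
  "grad f x = (THE D. GDERIV f x :> D)"

definition phi_white :: "(real^'n) set \<Rightarrow> real^'n \<Rightarrow> real" where
  "phi_white \<Delta> q = (SUP p\<in>\<Delta>. p \<bullet> q)"

definition phi_black :: "(real^'n) set \<Rightarrow> real^'n \<Rightarrow> real" where
  "phi_black \<Delta> q = (INF p\<in>\<Delta>. p \<bullet> q)"

text \<open>The kernel is positive on the whole open ball, so that the function \<open>edge_fun\<close> below vanishes
  exactly on \<open>edge_region\<close>.\<close>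

definition smoothing_kernel :: "real \<Rightarrow> (real^'n \<Rightarrow> real) \<Rightarrow> bool" where
  "smoothing_kernel R \<rho> \<longleftrightarrow> 0 < R \<and> smooth_on \<rho> UNIV \<and> (\<forall>y. 0 \<le> \<rho> y) \<and>
     {y. \<rho> y \<noteq> 0} = ball 0 R \<and> (LINT y|lborel. \<rho> y) = 1"

definition mollify :: "(real^'n \<Rightarrow> real) \<Rightarrow> (real^'n \<Rightarrow> real) \<Rightarrow> real^'n \<Rightarrow> real" where
  "mollify \<rho> \<phi> q = (LINT y|lborel. \<phi> (q - y) * \<rho> y) - (LINT y|lborel. \<phi> (0 - y) * \<rho> y)"


section \<open>Surgery data\<close>

record ('n::finite) surgery =
  kernel :: "real^'n \<Rightarrow> real"
  radius :: real
  width :: "'n dimer_edge \<Rightarrow> real"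
  r_prof :: "'n dimer_edge \<Rightarrow> real \<Rightarrow> real"
  s_prof :: "'n dimer_edge \<Rightarrow> real \<Rightarrow> real"

abbreviation sphi_white :: "'n surgery \<Rightarrow> (real^'n) set \<Rightarrow> real^'n \<Rightarrow> real" where
  "sphi_white D \<Delta> \<equiv> mollify (kernel D) (phi_white \<Delta>)"

abbreviation sphi_black :: "'n surgery \<Rightarrow> (real^'n) set \<Rightarrow> real^'n \<Rightarrow> real" where
  "sphi_black D \<Delta> \<equiv> mollify (kernel D) (phi_black \<Delta>)"

definition linearity_cone :: "'n dimer_edge \<Rightarrow> (real^'n) set" where
  "linearity_cone e = {q. phi_black (black e) q = bvert e \<bullet> q \<and> phi_white (white e) q = wvert e \<bullet> q}"

definition edge_region :: "real \<Rightarrow> 'n dimer_edge \<Rightarrow> (real^'n) set" where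
  "edge_region R e = {q. ball q R \<subseteq> linearity_cone e}"

text \<open>\<open>edge_fun D e\<close> is \<open>f\<^sub>e\<close>: the difference of the mollified white and black functions, corrected by
  the integral linear function which makes it constant on \<open>edge_region\<close>, and by that constant.\<close>

definition edge_gap :: "'n surgery \<Rightarrow> 'n dimer_edge \<Rightarrow> real^'n \<Rightarrow> real" where
  "edge_gap D e q = sphi_white D (white e) q - sphi_black D (black e) q - (wvert e - bvert e) \<bullet> q"

definition edge_fun :: "'n surgery \<Rightarrow> 'n dimer_edge \<Rightarrow> real^'n \<Rightarrow> real" where
  "edge_fun D e q = edge_gap D e q - edge_gap D e (SOME q0. q0 \<in> edge_region (radius D) e)"

text \<open>Profile functions matter only on \<open>{\<epsilon>/2<..}\<close>. The smooth embedded curve \<open>u \<mapsto> (x u, y u)\<close> runs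
  through the graph of \<open>s'\<close> for \<open>u < 0\<close>, through the graph of \<open>r'\<close> for \<open>u > 0\<close>, and through a single
  closing point over \<open>\<epsilon>/2\<close> for \<open>u = 0\<close>.\<close>

definition profile_pair :: "real \<Rightarrow> (real \<Rightarrow> real) \<Rightarrow> (real \<Rightarrow> real) \<Rightarrow> bool" where
  "profile_pair \<epsilon> r s \<longleftrightarrow> 0 < \<epsilon> \<and> smooth_on r {\<epsilon>/2<..} \<and> smooth_on s {\<epsilon>/2<..} \<and>
     (\<forall>t\<ge>\<epsilon>. deriv r t = 1 \<and> deriv s t = 0) \<and>
     (\<exists>x y :: real \<Rightarrow> real. smooth_on x UNIV \<and> smooth_on y UNIV \<and>
        inj (\<lambda>u. (x u, y u)) \<and> (\<forall>u. (deriv x u, deriv y u) \<noteq> (0, 0)) \<and> x 0 = \<epsilon>/2 \<and>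
        (\<lambda>u. (x u, y u)) ` {0<..} = {(t, deriv r t) | t. \<epsilon>/2 < t} \<and>
        (\<lambda>u. (x u, y u)) ` {..<0} = {(t, deriv s t) | t. \<epsilon>/2 < t})"

text \<open>The last condition says that the surgeries take place near the regions \<open>edge_region\<close>: those
  which modify the same section are performed over disjoint sets.\<close>

definition surgery_data :: "(real^'n) set set \<Rightarrow> (real^'n) set set \<Rightarrow> 'n surgery \<Rightarrow> bool" where
  "surgery_data B W D \<longleftrightarrow> smoothing_kernel (radius D) (kernel D) \<and>
     (\<forall>e\<in>dimer_edges B W. profile_pair (width D e) (r_prof D e) (s_prof D e)) \<and>
     (\<forall>e\<in>dimer_edges B W. \<forall>e'\<in>dimer_edges B W.
        e \<noteq> e' \<and> (black e = black e' \<or> white e = white e') \<longrightarrow>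
        {q. edge_fun D e q \<le> width D e} \<inter> {q. edge_fun D e' q \<le> width D e'} = {})"


section \<open>Immersed Lagrangians and exactness\<close>

text \<open>The universal cover \<open>T\<^sup>*Q \<rightarrow> T\<^sup>*Q / T\<^sup>*\<^sub>\<int>Q\<close>, the quotient being identified with \<open>(\<complex>\<^sup>*)\<^sup>n\<close>.\<close>

definition covering :: "(real^'n) \<times> (real^'n) \<Rightarrow> complex^'n" where
  "covering x = (\<chi> i. exp (Complex (fst x $ i) (2 * pi * snd x $ i)))"

definition eta :: "(real^'n) \<times> (real^'n) \<Rightarrow> (real^'n) \<times> (real^'n) \<Rightarrow> real" where
  "eta x v = fst x \<bullet> snd v"

text \<open>Sections belonging to different polytopes may intersect, so a dimer Lagrangian is in general only
  immersed in \<open>(\<complex>\<^sup>*)\<^sup>n\<close>, and its primitive is a function on the source of the immersion. That source is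
  given by patches, which are submanifolds of the universal cover mapped to \<open>(\<complex>\<^sup>*)\<^sup>n\<close> by \<open>covering\<close>, glued
  along open subsets of the patches by identifying points with the same image.\<close>

record ('i, 'n::finite) immersed_lagrangian =
  patches :: "'i set"
  patch :: "'i \<Rightarrow> ((real^'n) \<times> (real^'n)) set"
  gluing :: "(('i \<times> ((real^'n) \<times> (real^'n))) \<times> ('i \<times> ((real^'n) \<times> (real^'n)))) set"

text \<open>A function on the glued space is a function on each patch, with equal values at identified
  points. On a submanifold \<open>L\<close> of the cover, having derivative \<open>eta x\<close> at \<open>x\<close> within \<open>L\<close> means that the
  differential of the function on \<open>T\<^sub>xL\<close> is the restriction of the form \<open>q \<cdot> dp\<close>; smoothness of the
  function along \<open>L\<close> follows. The form is invariant under the deck group, which translates \<open>p\<close>.\<close>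

definition exact_lagrangian :: "('i, 'n::finite) immersed_lagrangian \<Rightarrow> bool" where
  "exact_lagrangian L \<longleftrightarrow> (\<exists>F :: 'i \<Rightarrow> (real^'n) \<times> (real^'n) \<Rightarrow> real.
     (\<forall>i\<in>patches L. \<forall>x\<in>patch L i. (F i has_derivative eta x) (at x within patch L i)) \<and>
     (\<forall>i x j y. ((i, x), (j, y)) \<in> gluing L \<longrightarrow> F i x = F j y))"


section \<open>The dimer Lagrangian\<close>

definition neck_base :: "'n surgery \<Rightarrow> 'n dimer_edge \<Rightarrow> (real^'n) set" where
  "neck_base D e = {q. width D e / 2 < edge_fun D e q \<and> edge_fun D e q < width D e}"

definition black_branch :: "'n surgery \<Rightarrow> 'n dimer_edge \<Rightarrow> ((real^'n) \<times> (real^'n)) set" where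
  "black_branch D e =
     (\<lambda>q. (q, grad (\<lambda>x. sphi_black D (black e) x + s_prof D e (edge_fun D e x)) q)) ` neck_base D e"

definition white_branch :: "'n surgery \<Rightarrow> 'n dimer_edge \<Rightarrow> ((real^'n) \<times> (real^'n)) set" where
  "white_branch D e =
     (\<lambda>q. (q, grad (\<lambda>x. sphi_black D (black e) x + r_prof D e (edge_fun D e x)) q)) ` neck_base D e"

text \<open>Taking the closure adds the points over \<open>f\<^sub>e = \<epsilon>\<^sub>e/2\<close>, where the two branches close up.\<close>

definition neck :: "'n surgery \<Rightarrow> 'n dimer_edge \<Rightarrow> ((real^'n) \<times> (real^'n)) set" where
  "neck D e = {x \<in> closure (black_branch D e \<union> white_branch D e). edge_fun D e (fst x) < width D e}"

text \<open>The sections after surgery, without the closing points. A white section and the white branch of a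
  neck live in lifts to the cover which differ by the lattice vector \<open>wvert e - bvert e\<close>.\<close>

definition black_sheet ::
  "(real^'n) set set \<Rightarrow> (real^'n) set set \<Rightarrow> 'n surgery \<Rightarrow> (real^'n) set \<Rightarrow> ((real^'n) \<times> (real^'n)) set"
where
  "black_sheet B W D \<Delta> =
     {(q, grad (sphi_black D \<Delta>) q) | q.
        \<forall>e\<in>dimer_edges B W. black e = \<Delta> \<longrightarrow> width D e \<le> edge_fun D e q} \<union>
     (\<Union>e\<in>{e \<in> dimer_edges B W. black e = \<Delta>}. black_branch D e)"

definition white_sheet ::
  "(real^'n) set set \<Rightarrow> (real^'n) set set \<Rightarrow> 'n surgery \<Rightarrow> (real^'n) set \<Rightarrow> ((real^'n) \<times> (real^'n)) set"
where
  "white_sheet B W D \<Delta> =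
     {(q, grad (sphi_white D \<Delta>) q) | q.
        \<forall>e\<in>dimer_edges B W. white e = \<Delta> \<longrightarrow> width D e \<le> edge_fun D e q} \<union>
     (\<Union>e\<in>{e \<in> dimer_edges B W. white e = \<Delta>}.
        (\<lambda>(q, p). (q, p + (wvert e - bvert e))) ` white_branch D e)"

datatype ('v, 'e) patch_label = Black 'v | White 'v | Neck 'e

type_synonym 'n label = "((real^'n) set, 'n dimer_edge) patch_label"

fun dimer_patch ::
  "(real^'n) set set \<Rightarrow> (real^'n) set set \<Rightarrow> 'n surgery \<Rightarrow> 'n label \<Rightarrow> ((real^'n) \<times> (real^'n)) set"
where
  "dimer_patch B W D (Black \<Delta>) = black_sheet B W D \<Delta>"
| "dimer_patch B W D (White \<Delta>) = white_sheet B W D \<Delta>"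
| "dimer_patch B W D (Neck e) = neck D e"

definition dimer_lagrangian ::
  "(real^'n) set set \<Rightarrow> (real^'n) set set \<Rightarrow> 'n surgery \<Rightarrow> ('n label, 'n) immersed_lagrangian"
where
  "dimer_lagrangian B W D =
     \<lparr> patches = Black ` B \<union> White ` W \<union> Neck ` dimer_edges B W,
       patch = dimer_patch B W D,
       gluing =
         {((Black (black e), x), (Neck e, y)) | e x y. e \<in> dimer_edges B W \<and>
            x \<in> black_sheet B W D (black e) \<and> y \<in> black_branch D e \<and> covering x = covering y} \<union>
         {((White (white e), x), (Neck e, y)) | e x y. e \<in> dimer_edges B W \<and>
            x \<in> white_sheet B W D (white e) \<and> y \<in> white_branch D e \<and> covering x = covering y} \<rparr>"

end

theory Submission
  imports Defs
begin

text \<open>On the graph of \<open>d\<Phi>\<close> the function \<open>q \<bullet> p - \<Phi> q\<close> is a primitive of \<open>eta\<close>; as a function on the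
  ambient space it already has derivative \<open>eta\<close> at the points of the graph, so only \<open>C\<^sup>1\<close> regularity of
  \<open>\<Phi>\<close> matters. After surgery the sheets have the potentials \<open>\<phi>\<^sub>b + s\<^sub>e \<circ> f\<^sub>e\<close> and \<open>\<phi>\<^sub>b + r\<^sub>e \<circ> f\<^sub>e\<close> near the
  neck of \<open>e\<close>. Away from the neck these differ only by constants from \<open>\<phi>\<^sub>b\<close> and, after
  subtracting an integral linear function, \<open>\<phi>\<^sub>w\<close>. The constants match around every cycle if the area between the two arcs of
  the profile curve is \<open>\<epsilon> + C - f\<^sub>e 0\<close>, where the constant \<open>C\<close>, by which black and white primitives are
  shifted against each other, does not depend on \<open>e\<close>. Arcs may bulge, so every sufficiently large area
  occurs, and \<open>C\<close> can be chosen large.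

  The surgeries are disjoint for an even kernel and a small width: if \<open>v\<close> is the difference of two vertices
  of one polytope, the sum of the corresponding functions \<open>f\<^sub>e\<close> is at least the mollification of
  \<open>\<bar>v \<bullet> q\<bar>\<close>, which is bounded below by its positive value at the origin. Duality of the edge directions
  is used only to see that \<open>edge_region\<close> is nonempty: a vertex of a polytope which maximises a linear
  functional along its edges maximises it on the polytope.\<close>

subsection \<open>Smooth functions\<close>

text \<open>On an open set a derivative depends only on nearby values, so agreement of two functions
  passes to their \<open>frechet_derivative\<close> terms and from there to every order.\<close>

lemma C_on_cong:
  assumes "open S" "\<And>x. x \<in> S \<Longrightarrow> f x = g x" "C_on k f S"
  shows "C_on k g S"
  using assms
proof (induction k arbitrary: f g)
  case 0
  then show ?case by (metis C_on.simps(1) continuous_on_cong)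
next
  case (Suc k)
  have d: "(g has_derivative frechet_derivative f (at x)) (at x)" if "x \<in> S" for x
  proof -
    have "f differentiable (at x)"
      using Suc.prems(1,3) that by (simp add: differentiable_on_eq_differentiable_at)
    then have "(f has_derivative frechet_derivative f (at x)) (at x)"
      by (simp add: frechet_derivative_works)
    then show ?thesis
      using has_derivative_transform_within_open Suc.prems(1,2) that by blast
  qed
  have e: "frechet_derivative f (at x) = frechet_derivative g (at x)" if "x \<in> S" for x
    using frechet_derivative_at[OF d[OF that]] .
  have "g differentiable_on S"
    using d Suc.prems(1) by (metis differentiable_def differentiable_on_eq_differentiable_at)
  moreover have "C_on k (\<lambda>x. frechet_derivative g (at x) b) S" if "b \<in> Basis" for b
    by (rule Suc.IH[OF Suc.prems(1), of "\<lambda>x. frechet_derivative f (at x) b"])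
       (use Suc.prems(3) e that in auto)
  ultimately show ?case by simp
qed

text \<open>Together with \<open>C_on_SucE\<close> this trades the choice term
  \<open>frechet_derivative\<close> for an arbitrary family of derivatives, so that inductions on
  the order need only the usual derivative rules.\<close>

lemma C_on_SucI:
  assumes "open S" "\<And>x. x \<in> S \<Longrightarrow> (f has_derivative f' x) (at x)"
    and "\<And>b. b \<in> Basis \<Longrightarrow> C_on k (\<lambda>x. f' x b) S"
  shows "C_on (Suc k) f S"
proof -
  have "f differentiable_on S"
    using assms by (metis differentiable_def differentiable_on_eq_differentiable_at)
  moreover have "C_on k (\<lambda>x. frechet_derivative f (at x) b) S" if "b \<in> Basis" for b
    by (rule C_on_cong[OF assms(1) _ assms(3)[OF that]])
       (use frechet_derivative_at[OF assms(2)] in metis)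
  ultimately show ?thesis by simp
qed

lemma C_on_SucE:
  assumes "open S" "C_on (Suc k) f S"
  obtains f' where "\<And>x. x \<in> S \<Longrightarrow> (f has_derivative f' x) (at x)"
    and "\<And>b. b \<in> Basis \<Longrightarrow> C_on k (\<lambda>x. f' x b) S"
proof
  show "(f has_derivative frechet_derivative f (at x)) (at x)" if "x \<in> S" for x
    using assms that by (auto simp: differentiable_on_eq_differentiable_at frechet_derivative_works)
qed (use assms in auto)

lemma C_on_Suc_real:
  fixes f :: "real \<Rightarrow> real"
  assumes "open S" "\<And>x. x \<in> S \<Longrightarrow> (f has_real_derivative f' x) (at x)" "C_on k f' S"
  shows "C_on (Suc k) f S"
  by (rule C_on_SucI[OF assms(1), of _ "\<lambda>x. (*) (f' x)"])
     (use assms in \<open>auto simp: has_field_derivative_def\<close>)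

lemma C_on_pred: "open S \<Longrightarrow> C_on (Suc k) f S \<Longrightarrow> C_on k f S"
proof (induction k arbitrary: f)
  case 0
  then show ?case by (simp add: differentiable_imp_continuous_on)
next
  case (Suc k)
  obtain f' where "\<And>x. x \<in> S \<Longrightarrow> (f has_derivative f' x) (at x)"
    and "\<And>b. b \<in> Basis \<Longrightarrow> C_on (Suc k) (\<lambda>x. f' x b) S"
    using C_on_SucE[OF Suc.prems] by blast
  then show ?case using C_on_SucI[OF Suc.prems(1)] Suc.IH[OF Suc.prems(1)] by blast
qed

lemma C_on_const: "open S \<Longrightarrow> C_on k (\<lambda>x. c) S"
proof (induction k arbitrary: c)
  case (Suc k)
  then show ?case by (intro C_on_SucI[of S _ "\<lambda>x v. 0"]) auto
qed simp

lemma C_on_add: "open S \<Longrightarrow> C_on k f S \<Longrightarrow> C_on k g S \<Longrightarrow> C_on k (\<lambda>x. f x + g x) S"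
proof (induction k arbitrary: f g)
  case 0
  then show ?case by (auto intro: continuous_intros)
next
  case (Suc k)
  obtain f' where "\<And>x. x \<in> S \<Longrightarrow> (f has_derivative f' x) (at x)"
    and "\<And>b. b \<in> Basis \<Longrightarrow> C_on k (\<lambda>x. f' x b) S"
    using C_on_SucE[OF Suc.prems(1,2)] by blast
  moreover obtain g' where "\<And>x. x \<in> S \<Longrightarrow> (g has_derivative g' x) (at x)"
    and "\<And>b. b \<in> Basis \<Longrightarrow> C_on k (\<lambda>x. g' x b) S"
    using C_on_SucE[OF Suc.prems(1,3)] by blast
  ultimately show ?case
    by (intro C_on_SucI[OF Suc.prems(1), of _ "\<lambda>x v. f' x v + g' x v"])
       (auto intro: has_derivative_add Suc.IH Suc.prems(1))
qed

lemma C_on_mult: "open S \<Longrightarrow> C_on k f S \<Longrightarrow> C_on k g S \<Longrightarrow> C_on k (\<lambda>x. f x * g x) S"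
proof (induction k arbitrary: f g)
  case 0
  then show ?case by (auto intro: continuous_intros)
next
  case (Suc k)
  obtain f' where f: "\<And>x. x \<in> S \<Longrightarrow> (f has_derivative f' x) (at x)"
    and f': "\<And>b. b \<in> Basis \<Longrightarrow> C_on k (\<lambda>x. f' x b) S"
    using C_on_SucE[OF Suc.prems(1,2)] by blast
  obtain g' where g: "\<And>x. x \<in> S \<Longrightarrow> (g has_derivative g' x) (at x)"
    and g': "\<And>b. b \<in> Basis \<Longrightarrow> C_on k (\<lambda>x. g' x b) S"
    using C_on_SucE[OF Suc.prems(1,3)] by blast
  \<comment> \<open>The undifferentiated factors in the product rule have order
    \<open>Suc k\<close>; \<open>C_on_pred\<close> lowers them to the order of the induction
    hypothesis.\<close>
  have "C_on k (\<lambda>x. f x * g' x b + f' x b * g x) S" if "b \<in> Basis" for b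
    by (intro C_on_add Suc.IH Suc.prems(1) f' g' that C_on_pred[OF Suc.prems(1,2)]
        C_on_pred[OF Suc.prems(1,3)])
  then show ?case
    by (intro C_on_SucI[OF Suc.prems(1), of _ "\<lambda>x v. f x * g' x v + f' x v * g x"])
       (auto intro: has_derivative_mult f g)
qed

lemma C_on_bounded_linear: "open S \<Longrightarrow> bounded_linear f \<Longrightarrow> C_on k f S"
proof (cases k)
  case (Suc m)
  assume "open S" "bounded_linear f"
  then show ?thesis unfolding Suc
    by (intro C_on_SucI[of S _ "\<lambda>x. f"]) (auto intro: bounded_linear_imp_has_derivative C_on_const)
qed (auto intro: linear_continuous_on)

lemma C_on_compose:
  assumes "open S" "open T" "f ` S \<subseteq> T" "C_on k g T" "C_on k f S"
  shows "C_on k (\<lambda>x. g (f x) :: real) S"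
  using assms(4,5)
proof (induction k arbitrary: g)
  case 0
  then show ?case using assms by (auto intro: continuous_on_compose2)
next
  case (Suc k)
  obtain f' where f: "\<And>x. x \<in> S \<Longrightarrow> (f has_derivative f' x) (at x)"
    and f': "\<And>b. b \<in> Basis \<Longrightarrow> C_on k (\<lambda>x. f' x b) S"
    using C_on_SucE[OF assms(1) Suc.prems(2)] by blast
  obtain g' where g: "\<And>x. x \<in> T \<Longrightarrow> (g has_derivative g' x) (at x)"
    and g': "\<And>b. b \<in> Basis \<Longrightarrow> C_on k (\<lambda>x. g' x b) T"
    using C_on_SucE[OF assms(2) Suc.prems(1)] by blast
  have "((\<lambda>x. g (f x)) has_derivative (\<lambda>v. g' (f x) 1 * f' x v)) (at x)" if "x \<in> S" for x
  proof -
    have y: "f x \<in> T" using assms(3) that by blast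
    \<comment> \<open>The outer function lives on the real line, so its derivative is multiplication
      by its value at 1, and the chain rule becomes a product.\<close>
    have lin: "g' (f x) v = g' (f x) 1 * v" for v
      using linear_scale[OF has_derivative_linear[OF g[OF y]], of v 1] by simp
    show ?thesis
      by (rule has_derivative_eq_rhs[OF has_derivative_compose[OF f[OF that] g[OF y]]], intro ext)
        (rule lin)
  qed
  moreover have "C_on k (\<lambda>x. g' (f x) 1 * f' x b) S" if "b \<in> Basis" for b
  proof -
    have "C_on k (\<lambda>x. g' (f x) 1) S"
      by (rule Suc.IH[of "\<lambda>y. g' y 1", OF g' C_on_pred[OF assms(1) Suc.prems(2)]]) simp
    then show ?thesis using C_on_mult[OF assms(1) _ f'[OF that]] by simp
  qed
  ultimately show ?case by (rule C_on_SucI[OF assms(1)])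
qed

text \<open>Differentiation lowers the exponent by one, hence the induction over all real exponents.
  The exponent 1/2 serves the square root that parametrises the profiles.\<close>

lemma C_on_powr: "C_on k (\<lambda>x. x powr a) {0<..}"
proof (induction k arbitrary: a)
  case 0
  then show ?case by (auto intro!: continuous_intros)
next
  case (Suc k)
  show ?case
    by (rule C_on_Suc_real[where f' = "\<lambda>x. a * x powr (a - 1)"])
       (auto intro!: C_on_mult C_on_const Suc has_real_derivative_powr)
qed

text \<open>All derivatives of \<open>exp (- 1/t)\<close> are combinations of the functions \<open>flat n\<close>.\<close>

definition flat :: "nat \<Rightarrow> real \<Rightarrow> real" where
  "flat n t = (if 0 < t then inverse t ^ n * exp (- inverse t) else 0)"

lemma flat_tendsto: "(flat n \<longlongrightarrow> 0) (at 0)"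
proof -
  have "((\<lambda>t. t ^ n / exp t) \<longlongrightarrow> (0::real)) at_top"
    by (rule tendsto_power_div_exp_0)
  then have "((\<lambda>t. inverse t ^ n / exp (inverse t)) \<longlongrightarrow> (0::real)) (at_right 0)"
    by (rule filterlim_compose[OF _ filterlim_inverse_at_top_right])
  moreover have "eventually (\<lambda>t. flat n t = inverse t ^ n / exp (inverse t)) (at_right 0)"
    unfolding flat_def eventually_at_filter by (auto simp: exp_minus divide_simps)
  ultimately have "(flat n \<longlongrightarrow> 0) (at_right 0)"
    by (simp add: filterlim_cong)
  moreover have "eventually (\<lambda>t. flat n t = 0) (at_left 0)"
    unfolding flat_def eventually_at_filter by auto
  then have "(flat n \<longlongrightarrow> 0) (at_left 0)"
    by (simp add: tendsto_eventually)
  ultimately show ?thesis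
    by (simp add: filterlim_at_split)
qed

lemma flat_has_derivative:
  "(flat n has_real_derivative (flat (n + 2) t - n * flat (n + 1) t)) (at t)"
proof -
  consider "t > 0" | "t < 0" | "t = 0" by linarith
  then show ?thesis
  proof cases
    case 1
    have i: "(inverse has_real_derivative - (inverse t ^ 2)) (at t)"
      using DERIV_inverse[of t UNIV] 1 by (simp add: numeral_2_eq_2)
    have "((\<lambda>t. inverse t ^ n) has_real_derivative - (n * inverse t ^ (n + 1))) (at t)"
      using DERIV_power[OF i, of n] by (cases n) (simp_all add: power2_eq_square algebra_simps)
    moreover have "((\<lambda>t. exp (- inverse t)) has_real_derivative inverse t ^ 2 * exp (- inverse t)) (at t)"
      using DERIV_fun_exp[OF DERIV_minus[OF i]] by (simp add: ac_simps)
    ultimately have "((\<lambda>t. inverse t ^ n * exp (- inverse t)) has_real_derivative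
        (flat (n + 2) t - n * flat (n + 1) t)) (at t)"
      by (rule DERIV_cong[OF DERIV_mult]) (use 1 in \<open>simp add: flat_def algebra_simps power_add power2_eq_square\<close>)
    then show ?thesis
      by (rule has_field_derivative_transform_within_open[of _ _ _ "{0<..}"])
         (use 1 in \<open>auto simp: flat_def\<close>)
  next
    case 2
    have "((\<lambda>t. 0) has_real_derivative (flat (n + 2) t - n * flat (n + 1) t)) (at t)"
      using 2 unfolding flat_def by simp
    then show ?thesis
      by (rule has_field_derivative_transform_within_open[of _ _ _ "{..<0}"])
         (use 2 in \<open>auto simp: flat_def\<close>)
  next
    case 3
    \<comment> \<open>Dividing by h raises the power of \<open>inverse h\<close> by one: the
      difference quotient at 0 is again a flat function, with limit 0.\<close>
    have "(\<lambda>h. (flat n (0 + h) - flat n 0) / h) = flat (n + 1)"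
      by (auto simp: flat_def field_simps)
    then have "(flat n has_real_derivative 0) (at 0)"
      unfolding DERIV_def using flat_tendsto[of "n + 1"] by simp
    then show ?thesis using 3 by (simp add: flat_def)
  qed
qed

lemma C_on_flat: "C_on k (flat n) UNIV"
proof (induction k arbitrary: n)
  case 0
  show ?case
    using DERIV_isCont[OF flat_has_derivative] by (simp add: continuous_at_imp_continuous_on)
next
  case (Suc k)
  show ?case
    by (rule C_on_Suc_real[where f' = "\<lambda>t. flat (n + 2) t + (- real n) * flat (n + 1) t"])
       (use flat_has_derivative[of n] in \<open>simp_all only: open_UNIV mult_minus_left diff_conv_add_uminus\<close>,
        use C_on_add[OF open_UNIV Suc C_on_mult[OF open_UNIV C_on_const[OF open_UNIV, of k "- real n"] Suc],
          of "n + 2" "n + 1"] in simp)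
qed

lemma flat_pos_iff: "0 < flat n t \<longleftrightarrow> 0 < t"
  by (simp add: flat_def)

lemma flat_nonneg: "0 \<le> flat n t"
  by (simp add: flat_def)

section \<open>Antiderivatives and derivatives of functions of one variable\<close>

lemma smooth_on_antiderivative:
  fixes F :: "real \<Rightarrow> real"
  assumes "\<And>x. (F has_real_derivative f x) (at x)" "smooth_on f UNIV"
  shows "smooth_on F UNIV"
  unfolding smooth_on_def
proof
  fix k
  show "C_on k F UNIV"
    using C_on_pred[OF _ C_on_Suc_real[of UNIV F f k]] assms by (auto simp: smooth_on_def)
qed

lemma smooth_on_imp_continuous_on: "smooth_on f S \<Longrightarrow> continuous_on S f"
  using C_on.simps(1) unfolding smooth_on_def by blast

lemma continuous_antiderivative:
  fixes f :: "real \<Rightarrow> real"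
  assumes "continuous_on UNIV f"
  obtains F where "\<And>x. (F has_real_derivative f x) (at x)"
proof -
  have "\<exists>F. \<forall>x :: real. -\<infinity> < ereal x \<longrightarrow> ereal x < \<infinity> \<longrightarrow> (F has_vector_derivative f x) (at x)"
    by (rule einterval_antiderivative) (use assms in \<open>auto simp: continuous_on_eq_continuous_at\<close>)
  then obtain F where F: "\<And>x. (F has_real_derivative f x) (at x)"
    by (auto simp: has_real_derivative_iff_has_vector_derivative)
  then show thesis by (rule that)
qed

lemma smooth_on_deriv_real:
  assumes "open S" "smooth_on f S" "x \<in> S"
  shows "(f has_real_derivative deriv f x) (at x)"
proof -
  have "C_on 1 f S" using assms(2) unfolding smooth_on_def by blast
  then have "f differentiable (at x)"
    using assms by (simp add: differentiable_on_eq_differentiable_at)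
  then show ?thesis
    using field_differentiable_derivI[of f x]
    by (metis DERIV_imp_deriv real_differentiableE)
qed

lemma smooth_on_deriv_continuous:
  fixes f :: "real \<Rightarrow> real"
  assumes "open S" "smooth_on f S"
  shows "continuous_on S (deriv f)"
proof -
  have "C_on 1 f S" using assms(2) unfolding smooth_on_def by blast
  then have "continuous_on S (\<lambda>x. frechet_derivative f (at x) 1)" by simp
  moreover have "frechet_derivative f (at x) 1 = deriv f x" if "x \<in> S" for x
    using fun_cong[OF frechet_derivative_at[OF smooth_on_deriv_real[OF assms that,
          unfolded has_field_derivative_def]], of 1] by simp
  ultimately show ?thesis by (rule continuous_on_eq)
qed

subsection \<open>Edges at a vertex of a polytope\<close>

text \<open>Passing to a facet through the vertex lowers the dimension by one, and faces of faces
  are faces. The descent ends at a face of dimension one.\<close>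

lemma edge_at_vertex_exists:
  assumes "polytope P" "p extreme_point_of P" "P \<noteq> {p}"
  obtains E where "E edge_of P" "p \<in> E"
  using assms
proof (induction "nat (aff_dim P)" arbitrary: P thesis rule: less_induct)
  case less
  have pP: "{p} face_of P" "p \<in> P"
    using less.prems(3) by (auto simp: face_of_singleton extreme_point_of_def)
  have "aff_dim P \<noteq> -1" using pP(2) by (metis aff_dim_empty empty_iff)
  moreover have "aff_dim P \<noteq> 0" using pP less.prems(4) by (auto simp: aff_dim_eq_0)
  ultimately have d: "1 \<le> aff_dim P" using aff_dim_geq[of P] by linarith
  show ?case
  proof (cases "aff_dim P = 1")
    case True
    then show ?thesis
      using less.prems(1)[of P] pP polytope_imp_convex[OF less.prems(2)]
      by (auto simp: edge_of_def face_of_refl)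
  next
    case False
    obtain F where F: "F facet_of P" "{p} \<subseteq> F"
      using face_of_polyhedron_subset_facet[OF polytope_imp_polyhedron[OF less.prems(2)] pP(1)]
        less.prems(4) by auto
    have FP: "F face_of P" and dF: "aff_dim F = aff_dim P - 1"
      using F by (auto simp: facet_of_def)
    have "polytope F" using face_of_polytope_polytope[OF less.prems(2) FP] .
    moreover have "p extreme_point_of F"
      using extreme_point_of_face[OF FP] less.prems(3) F by auto
    moreover have "F \<noteq> {p}" using dF d False by auto
    moreover have "nat (aff_dim F) < nat (aff_dim P)" using dF d by simp
    ultimately obtain E where "E edge_of F" "p \<in> E"
      using less.hyps[of F] by blast
    then show ?thesis
      using less.prems(1) FP face_of_trans by (auto simp: edge_of_def)
  qed
qed

text \<open>Every proper face of a polyhedron is cut out by a supporting hyperplane; its normal is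
  negated so that p becomes a strict minimum.\<close>

lemma exposed_vertex:
  fixes P :: "'a::euclidean_space set"
  assumes "polytope P" "p extreme_point_of P"
  obtains h where "\<And>y. y \<in> P \<Longrightarrow> y \<noteq> p \<Longrightarrow> h \<bullet> p < h \<bullet> y"
proof -
  have "{p} exposed_face_of P"
    using assms by (simp add: exposed_face_of_polyhedron polytope_imp_polyhedron face_of_singleton)
  then obtain a b where ab: "P \<subseteq> {x. a \<bullet> x \<le> b}" "{p} = P \<inter> {x. a \<bullet> x = b}"
    unfolding exposed_face_of_def by blast
  show thesis
  proof (rule that[of "- a"])
    fix y assume "y \<in> P" "y \<noteq> p"
    then have "a \<bullet> y \<le> b" "a \<bullet> y \<noteq> b" using ab by auto
    moreover have "a \<bullet> p = b" using ab by auto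
    ultimately show "- a \<bullet> p < - a \<bullet> y" by simp
  qed
qed

lemma linear_le_on_polytope:
  fixes c :: "'a::euclidean_space"
  assumes "polytope P" "\<And>v. v extreme_point_of P \<Longrightarrow> c \<bullet> v \<le> b" "x \<in> P"
  shows "c \<bullet> x \<le> b"
proof -
  have "P = convex hull {v. v extreme_point_of P}"
    by (rule Krein_Milman_Minkowski) (use assms(1) polytope_imp_compact polytope_imp_convex in auto)
  moreover have "convex hull {v. v extreme_point_of P} \<subseteq> {x. c \<bullet> x \<le> b}"
    by (rule hull_minimal) (use assms convex_halfspace_le in auto)
  ultimately show ?thesis using assms(3) by blast
qed

lemma finite_extreme_points:
  fixes P :: "'a::euclidean_space set"
  shows "polytope P \<Longrightarrow> finite {v. v extreme_point_of P}"
  by (rule finite_polyhedron_extreme_points[OF polytope_imp_polyhedron])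

text \<open>If \<open>c\<close> improved somewhere, then subtracting the right multiple of a functional \<open>h\<close> exposing \<open>p\<close>
  would give a face through \<open>p\<close> along which \<open>c\<close> increases, and that face has an edge at \<open>p\<close>.\<close>

lemma edge_optimal_vertex_is_optimal:
  fixes c :: "'a::euclidean_space"
  assumes P: "polytope P" and p: "p extreme_point_of P"
    and edge: "\<And>E x. E edge_of P \<Longrightarrow> p \<in> E \<Longrightarrow> x \<in> E \<Longrightarrow> c \<bullet> x \<le> c \<bullet> p"
    and x: "x \<in> P"
  shows "c \<bullet> x \<le> c \<bullet> p"
proof (rule ccontr)
  assume "\<not> c \<bullet> x \<le> c \<bullet> p"
  then obtain v where v: "v extreme_point_of P" "c \<bullet> v > c \<bullet> p"
    using linear_le_on_polytope[OF P _ x, of c "c \<bullet> p"] not_le by blast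
  obtain h where h: "\<And>y. y \<in> P \<Longrightarrow> y \<noteq> p \<Longrightarrow> h \<bullet> p < h \<bullet> y"
    using exposed_vertex[OF P p] by blast
  define V where "V = {v. v extreme_point_of P} - {p}"
  \<comment> \<open>\<open>s y\<close> is the multiple of h at which y stops improving on p.
    Subtracting the largest such multiple t makes p optimal, while a vertex w attaining the maximum
    ties with p.\<close>
  define s where "s = (\<lambda>y. (c \<bullet> (y - p)) / (h \<bullet> (y - p)))"
  define t where "t = Max (s ` V)"
  have fin: "finite (s ` V)" using finite_extreme_points[OF P] by (simp add: V_def)
  have vV: "v \<in> V" using v by (auto simp: V_def)
  have VP: "y \<in> P" "h \<bullet> (y - p) > 0" if "y \<in> V" for y
    using that h[of y] by (auto simp: V_def extreme_point_of_def inner_diff_right)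
  have "0 < s v" using v VP[OF vV] by (simp add: s_def inner_diff_right)
  also have "s v \<le> t" unfolding t_def by (rule Max_ge) (use fin vV in auto)
  finally have t: "0 < t" .
  have "t \<in> s ` V" unfolding t_def by (rule Max_in) (use fin vV in auto)
  then obtain w where w: "w \<in> V" "s w = t" by auto
  define d where "d = c - t *\<^sub>R h"
  have dle: "d \<bullet> y \<le> d \<bullet> p" if "y \<in> P" for y
  proof (rule linear_le_on_polytope[OF P _ that])
    fix u assume u: "u extreme_point_of P"
    show "d \<bullet> u \<le> d \<bullet> p"
    proof (cases "u = p")
      case False
      then have "u \<in> V" using u by (simp add: V_def)
      then have "s u \<le> t" unfolding t_def by (intro Max_ge) (use fin in auto)
      then have "c \<bullet> (u - p) \<le> t * (h \<bullet> (u - p))"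
        using VP[OF \<open>u \<in> V\<close>] by (simp add: s_def divide_le_eq)
      then show ?thesis by (simp add: d_def inner_diff_right inner_diff_left algebra_simps)
    qed simp
  qed
  define F where "F = P \<inter> {y. d \<bullet> y = d \<bullet> p}"
  have F: "F face_of P"
    unfolding F_def by (rule face_of_Int_supporting_hyperplane_le) (use P dle polytope_imp_convex in auto)
  have "c \<bullet> (w - p) = t * (h \<bullet> (w - p))"
    using w VP[OF w(1)] by (auto simp: s_def)
  then have "w \<in> F" using VP[OF w(1)]
    by (simp add: F_def d_def inner_diff_right inner_diff_left algebra_simps)
  moreover have "w \<noteq> p" using w by (auto simp: V_def)
  moreover have pF: "p \<in> F" using p by (auto simp: F_def extreme_point_of_def)
  ultimately have "F \<noteq> {p}" by auto
  moreover have "p extreme_point_of F" using extreme_point_of_face[OF F] p pF by auto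
  ultimately obtain E where E: "E edge_of F" "p \<in> E"
    using edge_at_vertex_exists[OF face_of_polytope_polytope[OF P F]] by blast
  then have "E edge_of P" using F face_of_trans by (auto simp: edge_of_def)
  have "E \<noteq> {p}" using E by (auto simp: edge_of_def)
  then obtain y where y: "y \<in> E" "y \<noteq> p" using E by blast
  then have "y \<in> F" using E edge_of_imp_subset by blast
  then have "d \<bullet> y = d \<bullet> p" "y \<in> P" by (auto simp: F_def)
  \<comment> \<open>On F the functional c increases from p exactly as t times h does, and h has its
    strict minimum at p.\<close>
  then have "c \<bullet> (y - p) = t * (h \<bullet> (y - p))"
    by (simp add: d_def inner_diff_right inner_diff_left algebra_simps)
  also have "\<dots> > 0" using t h[OF \<open>y \<in> P\<close> y(2)] by (simp add: inner_diff_right)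
  finally show False
    using edge[OF \<open>E edge_of P\<close> E(2) y(1)] by (simp add: inner_diff_right)
qed

text \<open>A functional exposing the vertex of one polytope is negative on the opposite edges of the other.
  This survives small perturbations, because it has a uniform margin at the finitely many vertices.\<close>

lemma opposite_edges_imp_common_linearity:
  fixes P Q :: "(real^'n) set"
  assumes P: "polytope P" "p extreme_point_of P" and Q: "polytope Q" "q extreme_point_of Q"
    and opp: "edge_directions P p = uminus ` edge_directions Q q"
  obtains z where "\<And>u x. u \<in> ball z R \<Longrightarrow> x \<in> P \<Longrightarrow> p \<bullet> u \<le> x \<bullet> u"
    and "\<And>u x. u \<in> ball z R \<Longrightarrow> x \<in> Q \<Longrightarrow> x \<bullet> u \<le> q \<bullet> u"
proof -
  obtain h where h: "\<And>y. y \<in> P \<Longrightarrow> y \<noteq> p \<Longrightarrow> h \<bullet> p < h \<bullet> y"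
    using exposed_vertex[OF P] by blast
  define V where "V = {v. v extreme_point_of P} - {p}"
  have fin: "finite V" using finite_extreme_points[OF P(1)] by (simp add: V_def)
  \<comment> \<open>By Cauchy-Schwarz, moving within the ball changes the pairing with v - p by at
    most \<bar>R\<bar> times its norm. N scales h until its margin at every other vertex covers
    this; the inserted 0 serves an empty V.\<close>
  define N where "N = Max (insert 0 ((\<lambda>v. \<bar>R\<bar> * norm (v - p) / (h \<bullet> (v - p))) ` V))"
  have N: "\<bar>R\<bar> * norm (v - p) \<le> N * (h \<bullet> (v - p))" if "v \<in> V" for v
  proof -
    have "0 < h \<bullet> (v - p)"
      using that h[of v] by (auto simp: V_def extreme_point_of_def inner_diff_right)
    moreover have "\<bar>R\<bar> * norm (v - p) / (h \<bullet> (v - p)) \<le> N"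
      unfolding N_def by (rule Max_ge) (use fin that in auto)
    ultimately show ?thesis by (simp add: divide_le_eq)
  qed
  have black: "p \<bullet> u \<le> x \<bullet> u" if u: "u \<in> ball (N *\<^sub>R h) R" and x: "x \<in> P" for u x
  proof -
    have "(- u) \<bullet> x \<le> (- u) \<bullet> p"
    proof (rule linear_le_on_polytope[OF P(1) _ x])
      fix v assume v: "v extreme_point_of P"
      show "- u \<bullet> v \<le> - u \<bullet> p"
      proof (cases "v = p")
        case False
        then have "v \<in> V" using v by (simp add: V_def)
        have "- ((u - N *\<^sub>R h) \<bullet> (v - p)) \<le> norm (u - N *\<^sub>R h) * norm (v - p)"
          using Cauchy_Schwarz_ineq2[of "u - N *\<^sub>R h" "v - p"] by linarith
        also have "\<dots> \<le> \<bar>R\<bar> * norm (v - p)"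
          using u by (intro mult_right_mono) (auto simp: dist_norm norm_minus_commute)
        also have "\<dots> \<le> (N *\<^sub>R h) \<bullet> (v - p)" using N[OF \<open>v \<in> V\<close>] by simp
        finally show ?thesis by (simp add: inner_diff_left inner_diff_right)
      qed simp
    qed
    then show ?thesis by (simp add: inner_commute)
  qed
  have white: "x \<bullet> u \<le> q \<bullet> u" if u: "u \<in> ball (N *\<^sub>R h) R" and x: "x \<in> Q" for u x
  proof -
    have "u \<bullet> x \<le> u \<bullet> q"
    proof (rule edge_optimal_vertex_is_optimal[OF Q _ x])
      fix E y assume E: "E edge_of Q" "q \<in> E" "y \<in> E"
      show "u \<bullet> y \<le> u \<bullet> q"
      proof (cases "y = q")
        case False
        then have "sgn (y - q) \<in> edge_directions Q q"
          unfolding edge_directions_def using E by blast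
        then have "- sgn (y - q) \<in> edge_directions P p"
          unfolding opp by (rule imageI)
        \<comment> \<open>The direction from q to y is opposite to that of an edge of P at p, along
          which u does not decrease by the first claim.\<close>
        then obtain E' x' where E': "E' edge_of P" "x' \<in> E'" "x' \<noteq> p" "sgn (x' - p) = - sgn (y - q)"
          unfolding edge_directions_def mem_Collect_eq by metis
        then have "x' \<in> P" using edge_of_imp_subset by blast
        then have "0 \<le> u \<bullet> (x' - p)"
          using black[OF u \<open>x' \<in> P\<close>] by (simp add: inner_diff_left inner_diff_right inner_commute)
        then have "0 \<le> u \<bullet> sgn (x' - p)" by (simp add: sgn_div_norm)
        then have "u \<bullet> sgn (y - q) \<le> 0" using E'(4) by simp
        then have "u \<bullet> (y - q) \<le> 0"
          using False by (simp add: sgn_div_norm mult_le_0_iff divide_le_0_iff)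
        then show ?thesis by (simp add: inner_diff_right)
      qed simp
    qed
    then show ?thesis by (simp add: inner_commute)
  qed
  show thesis using that black white by blast
qed

subsection \<open>Profile functions\<close>

text \<open>By the mean value theorem, difference quotients at a are values of f' between a and t.
  This yields the one-sided derivatives of the profiles at the closing point.\<close>

lemma right_derivative_from_limit:
  fixes f :: "real \<Rightarrow> real"
  assumes cont: "continuous_on {a..} f"
    and der: "\<And>t. a < t \<Longrightarrow> (f has_real_derivative f' t) (at t)"
    and lim: "(f' \<longlongrightarrow> l) (at_right a)"
  shows "(f has_real_derivative l) (at a within {a..})"
  unfolding has_field_derivative_iff
proof (rule tendstoI)
  fix e :: real assume "0 < e"
  from tendstoD[OF lim this] obtain b where b: "a < b" "\<And>t. a < t \<Longrightarrow> t < b \<Longrightarrow> dist (f' t) l < e"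
    unfolding eventually_at_right_field by blast
  have "dist ((f t - f a) / (t - a)) l < e" if t: "a < t" "t < b" for t
  proof -
    obtain z where z: "a < z" "z < t" "f t - f a = (t - a) * f' z"
      using MVT[of a t f] t(1) continuous_on_subset[OF cont, of "{a..t}"] der
      by (metis DERIV_unique atLeastAtMost_iff atLeast_iff real_differentiable_def subsetI)
    then show ?thesis using b(2)[of z] t by simp
  qed
  then show "\<forall>\<^sub>F t in at a within {a..}. dist ((f t - f a) / (t - a)) l < e"
    unfolding eventually_at using b(1)
    by (intro exI[of _ "b - a"]) (auto simp: dist_real_def)
qed

text \<open>The value \<open>r \<epsilon> - s \<epsilon>\<close> is the area enclosed by the two arcs of the profile curve, and \<open>y\<close> is the
  height of its closing point.\<close>

definition closed_profile :: "real \<Rightarrow> real \<Rightarrow> (real \<Rightarrow> real) \<Rightarrow> (real \<Rightarrow> real) \<Rightarrow> real \<Rightarrow> bool" where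
  "closed_profile A \<epsilon> r s y \<longleftrightarrow> profile_pair \<epsilon> r s \<and> r \<epsilon> - s \<epsilon> = A \<and> r (\<epsilon>/2) = s (\<epsilon>/2) \<and>
     (deriv r \<longlongrightarrow> y) (at_right (\<epsilon>/2)) \<and> (deriv s \<longlongrightarrow> y) (at_right (\<epsilon>/2)) \<and>
     (r has_real_derivative y) (at (\<epsilon>/2) within {\<epsilon>/2..}) \<and>
     (s has_real_derivative y) (at (\<epsilon>/2) within {\<epsilon>/2..}) \<and>
     (\<forall>t>\<epsilon>/2. deriv s t < deriv r t)"

lemma C_on_id: "C_on k (\<lambda>t::real. t) UNIV"
  by (intro C_on_bounded_linear) auto

lemma smooth_on_mult: "open S \<Longrightarrow> smooth_on f S \<Longrightarrow> smooth_on g S \<Longrightarrow> smooth_on (\<lambda>x. f x * g x) S"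
  and smooth_on_add: "open S \<Longrightarrow> smooth_on f S \<Longrightarrow> smooth_on g S \<Longrightarrow> smooth_on (\<lambda>x. f x + g x) S"
  and smooth_on_const: "open S \<Longrightarrow> smooth_on (\<lambda>x. c) S"
  by (simp_all add: smooth_on_def C_on_mult C_on_add C_on_const)

lemma C_on_sqrt_shift: "C_on k (\<lambda>t. sqrt (t - b)) {b<..}"
proof -
  have "C_on k (\<lambda>t. t + - b) {b<..}"
    by (intro C_on_add C_on_const C_on_bounded_linear) auto
  then have "C_on k (\<lambda>t. (t + - b) powr (1/2)) {b<..}"
    by (rule C_on_compose[OF _ _ _ C_on_powr, rotated -1]) auto
  then show ?thesis
    by (rule C_on_cong[rotated 2]) (auto simp: powr_half_sqrt)
qed

text \<open>The profile curve is u \<mapsto> (\<epsilon>/2 + u * u, y u). Since dx = 2 u du, P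
  integrates y dx along it, and r and s are P on the halves u > 0 and u < 0, expressed through x.
  The abscissa \<epsilon> belongs to u = sqrt (\<epsilon>/2) and its negative, so the enclosed area
  is the difference of P there.\<close>

lemma closed_profile_from_curve:
  fixes y P :: "real \<Rightarrow> real"
  assumes e: "0 < \<epsilon>" and ys: "smooth_on y UNIV" and y'0: "(y has_real_derivative y0') (at 0)" "y0' \<noteq> 0"
    and P: "\<And>u. (P has_real_derivative 2 * u * y u) (at u)"
    and y1: "\<And>u. u \<ge> sqrt (\<epsilon>/2) \<Longrightarrow> y u = 1" and y0: "\<And>u. u \<ge> sqrt (\<epsilon>/2) \<Longrightarrow> y (- u) = 0"
    and ylt: "\<And>u. 0 < u \<Longrightarrow> y (- u) < y u"
  shows "closed_profile (P (sqrt (\<epsilon>/2)) - P (- sqrt (\<epsilon>/2))) \<epsilon>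
    (\<lambda>t. P (sqrt (t - \<epsilon>/2))) (\<lambda>t. P (- sqrt (t - \<epsilon>/2))) (y 0)" (is "closed_profile _ _ ?r ?s _")
proof -
  have y_cont: "continuous_on UNIV y" by (rule smooth_on_imp_continuous_on[OF ys])
  have P_cont: "continuous_on UNIV P"
    using DERIV_isCont[OF P] by (simp add: continuous_at_imp_continuous_on)
  have P_smooth: "smooth_on P UNIV"
    by (rule smooth_on_antiderivative[OF P])
       (use ys C_on_id in \<open>auto intro!: smooth_on_mult simp: smooth_on_const, simp add: smooth_on_def\<close>)
  have r: "(?r has_real_derivative y (sqrt (t - \<epsilon>/2))) (at t)"
    and s: "(?s has_real_derivative y (- sqrt (t - \<epsilon>/2))) (at t)" if "\<epsilon>/2 < t" for t
  proof -
    have d: "((\<lambda>t. sqrt (t - \<epsilon>/2)) has_real_derivative inverse (sqrt (t - \<epsilon>/2)) / 2) (at t)"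
      using that by (auto intro!: derivative_eq_intros)
    have "sqrt (t - \<epsilon>/2) \<noteq> 0" using that by simp
    then show "(?r has_real_derivative y (sqrt (t - \<epsilon>/2))) (at t)"
      using DERIV_chain2[OF P d] by (simp add: field_simps)
    show "(?s has_real_derivative y (- sqrt (t - \<epsilon>/2))) (at t)"
      using DERIV_chain2[OF P DERIV_minus[OF d]] \<open>sqrt (t - \<epsilon>/2) \<noteq> 0\<close> by (simp add: field_simps)
  qed
  have dr: "deriv ?r t = y (sqrt (t - \<epsilon>/2))" and ds: "deriv ?s t = y (- sqrt (t - \<epsilon>/2))"
    if "\<epsilon>/2 < t" for t
    using r s that by (auto intro: DERIV_imp_deriv)
  have lim: "((\<lambda>t. y (sqrt (t - \<epsilon>/2))) \<longlongrightarrow> y 0) (at_right (\<epsilon>/2))"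
    "((\<lambda>t. y (- sqrt (t - \<epsilon>/2))) \<longlongrightarrow> y 0) (at_right (\<epsilon>/2))"
  proof -
    have "((\<lambda>t. sqrt (t - \<epsilon>/2)) \<longlongrightarrow> sqrt (\<epsilon>/2 - \<epsilon>/2)) (at_right (\<epsilon>/2))"
      by (intro tendsto_intros)
    then have l: "((\<lambda>t. sqrt (t - \<epsilon>/2)) \<longlongrightarrow> 0) (at_right (\<epsilon>/2))" by simp
    have yc: "isCont y 0" using y_cont by (simp add: continuous_on_eq_continuous_at)
    show "((\<lambda>t. y (sqrt (t - \<epsilon>/2))) \<longlongrightarrow> y 0) (at_right (\<epsilon>/2))"
      by (rule isCont_tendsto_compose[OF yc l])
    show "((\<lambda>t. y (- sqrt (t - \<epsilon>/2))) \<longlongrightarrow> y 0) (at_right (\<epsilon>/2))"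
      by (rule isCont_tendsto_compose[OF yc]) (use tendsto_minus[OF l] in simp)
  qed
  have smooth: "smooth_on ?r {\<epsilon>/2<..}" "smooth_on ?s {\<epsilon>/2<..}"
  proof -
    have "C_on k ?r {\<epsilon>/2<..}" "C_on k ?s {\<epsilon>/2<..}" for k
    proof -
      show "C_on k ?r {\<epsilon>/2<..}"
        by (rule C_on_compose[OF _ open_UNIV _ _ C_on_sqrt_shift]) (use P_smooth in \<open>auto simp: smooth_on_def\<close>)
      have "C_on k (\<lambda>t. - 1 * sqrt (t - \<epsilon>/2)) {\<epsilon>/2<..}"
        by (intro C_on_mult C_on_const C_on_sqrt_shift) auto
      then have "C_on k (\<lambda>t. - sqrt (t - \<epsilon>/2)) {\<epsilon>/2<..}" by simp
      from C_on_compose[OF _ open_UNIV _ _ this, of P] show "C_on k ?s {\<epsilon>/2<..}"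
        using P_smooth by (simp add: smooth_on_def)
    qed
    then show "smooth_on ?r {\<epsilon>/2<..}" "smooth_on ?s {\<epsilon>/2<..}" by (auto simp: smooth_on_def)
  qed
  have flat_ends: "deriv ?r t = 1 \<and> deriv ?s t = 0" if "t \<ge> \<epsilon>" for t
  proof -
    have "\<epsilon>/2 < t" "sqrt (\<epsilon>/2) \<le> sqrt (t - \<epsilon>/2)" using e that by (simp_all del: real_sqrt_divide)
    then show ?thesis using dr ds y1 y0 by simp
  qed
  define x where "x = (\<lambda>u::real. \<epsilon>/2 + u * u)"
  have x_smooth: "smooth_on x UNIV"
    unfolding x_def using C_on_id
    by (intro smooth_on_add smooth_on_const smooth_on_mult) (auto simp: smooth_on_def)
  have x': "deriv x u = 2 * u" for u
    unfolding x_def by (rule DERIV_imp_deriv) (auto intro!: derivative_eq_intros)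
  have "inj (\<lambda>u. (x u, y u))"
  proof (rule injI)
    fix u v assume uv: "(x u, y u) = (x v, y v)"
    \<comment> \<open>Equal abscissae leave only a sign, and \<open>ylt\<close> separates the
      heights over opposite parameters.\<close>
    then have "u = v \<or> u = - v" by (auto simp: x_def square_eq_iff)
    moreover have False if "u = - v" "u \<noteq> v"
      using that uv ylt[of v] ylt[of "- v"] by (cases "v > 0") auto
    ultimately show "u = v" by blast
  qed
  \<comment> \<open>The abscissa is critical only at u = 0, where the curve is vertical because y
    has nonzero derivative.\<close>
  moreover have "(deriv x u, deriv y u) \<noteq> (0, 0)" for u
    using x' DERIV_imp_deriv[OF y'0(1)] y'0(2) by (cases "u = 0") auto
  moreover have "(\<lambda>u. (x u, y u)) ` {0<..} = {(t, deriv ?r t) | t. \<epsilon>/2 < t}" (is "?L = ?R")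
  proof
    show "?L \<subseteq> ?R"
    proof clarify
      fix u :: real assume "u > 0"
      then show "\<exists>t. (x u, y u) = (t, deriv ?r t) \<and> \<epsilon>/2 < t"
        by (intro exI[of _ "x u"]) (simp add: dr x_def)
    qed
    show "?R \<subseteq> ?L"
    proof clarify
      fix t assume "\<epsilon>/2 < t"
      then show "(t, deriv ?r t) \<in> ?L"
        by (intro image_eqI[of _ _ "sqrt (t - \<epsilon>/2)"]) (simp_all add: dr x_def)
    qed
  qed
  moreover have "(\<lambda>u. (x u, y u)) ` {..<0} = {(t, deriv ?s t) | t. \<epsilon>/2 < t}" (is "?L = ?R")
  proof
    show "?L \<subseteq> ?R"
    proof clarify
      fix u :: real assume "u < 0"
      then show "\<exists>t. (x u, y u) = (t, deriv ?s t) \<and> \<epsilon>/2 < t"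
        by (intro exI[of _ "x u"]) (simp add: ds x_def mult_neg_neg)
    qed
    show "?R \<subseteq> ?L"
    proof clarify
      fix t assume "\<epsilon>/2 < t"
      then show "(t, deriv ?s t) \<in> ?L"
        by (intro image_eqI[of _ _ "- sqrt (t - \<epsilon>/2)"]) (simp_all add: ds x_def)
    qed
  qed
  ultimately have "profile_pair \<epsilon> ?r ?s"
    unfolding profile_pair_def using e smooth flat_ends x_smooth ys
    by (intro conjI allI impI exI[of _ x] exI[of _ y]) (auto simp: x_def)
  moreover have "continuous_on {\<epsilon>/2..} ?r" "continuous_on {\<epsilon>/2..} ?s"
    by (auto intro!: continuous_on_compose2[OF P_cont] continuous_intros)
  moreover have "(deriv ?r \<longlongrightarrow> y 0) (at_right (\<epsilon>/2))" "(deriv ?s \<longlongrightarrow> y 0) (at_right (\<epsilon>/2))"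
    by (rule tendsto_cong[THEN iffD1, OF _ lim(1)], simp add: eventually_at_filter dr,
        rule tendsto_cong[THEN iffD1, OF _ lim(2)], simp add: eventually_at_filter ds)
  moreover have "deriv ?s t < deriv ?r t" if "\<epsilon>/2 < t" for t
    using that by (simp add: dr ds ylt)
  ultimately show ?thesis
    unfolding closed_profile_def
    by (auto intro!: right_derivative_from_limit[OF _ r lim(1)] right_derivative_from_limit[OF _ s lim(2)])
qed

text \<open>For a smooth step from 0 to 1 as height function the area is the bound A0. Adding h
  times the odd function u * \<beta> u with h > 0 raises the upper arc and lowers the lower one, and
  the area grows linearly in h with positive rate, so all larger areas occur.\<close>

lemma closed_profile_exists:
  assumes e: "0 < \<epsilon>"
  obtains A0 where "\<And>A. A0 < A \<Longrightarrow> \<exists>r s y. closed_profile A \<epsilon> r s y"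
proof -
  \<comment> \<open>The abscissa \<epsilon>/2 + u * u equals \<epsilon> at u = a and u = - a, so
    heights may vary only between these parameters.\<close>
  define a where "a = sqrt (\<epsilon>/2)"
  have a: "0 < a" using e by (simp add: a_def)
  define \<beta> where "\<beta> = (\<lambda>v. flat 0 (a * a + - 1 * (v * v)))"
  have \<beta>_smooth: "smooth_on \<beta> UNIV"
    unfolding smooth_on_def \<beta>_def
    by (intro allI C_on_compose[OF _ open_UNIV _ C_on_flat] C_on_add C_on_mult C_on_const C_on_id) auto
  have \<beta>0: "\<beta> v = 0" if "a \<le> \<bar>v\<bar>" for v
  proof -
    have "a * a \<le> v * v" using that a by (metis abs_le_square_iff abs_of_pos power2_eq_square)
    then show ?thesis by (simp add: \<beta>_def flat_def)
  qed
  have \<beta>_even: "\<beta> (- v) = \<beta> v" for v by (simp add: \<beta>_def)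
  have \<beta>_pos: "0 < \<beta> v" if "\<bar>v\<bar> < a" for v
  proof -
    have "v * v < a * a" using that by (metis abs_ge_zero abs_mult_self_eq mult_strict_mono' )
    then show ?thesis by (simp add: \<beta>_def flat_pos_iff)
  qed
  have \<beta>_nonneg: "0 \<le> \<beta> v" for v by (simp add: \<beta>_def flat_nonneg)
  have \<beta>_cont: "continuous_on UNIV \<beta>" by (rule smooth_on_imp_continuous_on[OF \<beta>_smooth])
  obtain S where S: "\<And>v. (S has_real_derivative \<beta> v) (at v)"
    using continuous_antiderivative[OF \<beta>_cont] by blast
  have S_cont: "continuous_on UNIV S"
    using DERIV_isCont[OF S] by (simp add: continuous_at_imp_continuous_on)
  have S_mono: "S u \<le> S v" if "u \<le> v" for u v
    using DERIV_nonneg_imp_nondecreasing[OF that, of S] S \<beta>_nonneg by blast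
  have S_lt: "S (- a) < S a"
  proof (rule DERIV_pos_imp_increasing_open[of "- a" a S])
    show "- a < a" using a by simp
    show "\<exists>y. (S has_real_derivative y) (at v) \<and> 0 < y" if "- a < v" "v < a" for v
      using S[of v] \<beta>_pos[of v] that by (intro exI[of _ "\<beta> v"]) auto
    show "continuous_on {- a..a} S" by (rule continuous_on_subset[OF S_cont]) simp
  qed
  have S_right: "S u = S a" if "a \<le> u" for u
  proof (rule antisym)
    show "S u \<le> S a"
      by (rule DERIV_nonpos_imp_nonincreasing[OF that])
         (metis S \<beta>0 abs_ge_self order.trans order_refl)
  qed (rule S_mono[OF that])
  have S_left: "S (- u) = S (- a)" if "a \<le> u" for u
  proof (rule antisym)
    have "\<exists>y. (S has_real_derivative y) (at v) \<and> y \<le> 0" if "- u \<le> v" "v \<le> - a" for v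
      using S[of v] \<beta>0[of v] that a by auto
    then show "S (- a) \<le> S (- u)"
      using DERIV_nonpos_imp_nonincreasing[of "- u" "- a" S] that by auto
  qed (use S_mono that in auto)
  \<comment> \<open>The factor normalises the antiderivative of the bump to rise by exactly 1,
    giving the prescribed end slopes 0 and 1.\<close>
  define c where "c = inverse (S a - S (- a))"
  have c: "0 < c" using S_lt by (simp add: c_def)
  define \<sigma> where "\<sigma> = (\<lambda>u. c * (S u + - S (- a)))"
  have \<sigma>_smooth: "smooth_on \<sigma> UNIV"
    unfolding \<sigma>_def using smooth_on_antiderivative[OF S \<beta>_smooth]
    by (intro smooth_on_mult smooth_on_add smooth_on_const) auto
  have \<sigma>_cont: "continuous_on UNIV \<sigma>" by (rule smooth_on_imp_continuous_on[OF \<sigma>_smooth])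
  have \<sigma>1: "\<sigma> u = 1" and \<sigma>0: "\<sigma> (- u) = 0" if "a \<le> u" for u
    using S_right[OF that] S_left[OF that] S_lt by (simp_all add: \<sigma>_def c_def)
  have \<sigma>_mono: "\<sigma> u \<le> \<sigma> v" if "u \<le> v" for u v
    using S_mono[OF that] c by (simp add: \<sigma>_def)
  obtain P0 where P0: "\<And>u. (P0 has_real_derivative 2 * u * \<sigma> u) (at u)"
    by (rule continuous_antiderivative[of "\<lambda>u. 2 * u * \<sigma> u"])
       (intro continuous_intros \<sigma>_cont, blast)
  \<comment> \<open>P1 records what the bulge u * \<beta> u contributes to the integral of y dx; its
    integrand is nonnegative, so its increment over the interval is positive.\<close>
  obtain P1 where P1: "\<And>u. (P1 has_real_derivative 2 * u * (u * \<beta> u)) (at u)"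
    by (rule continuous_antiderivative[of "\<lambda>u. 2 * u * (u * \<beta> u)"])
       (intro continuous_intros \<beta>_cont, blast)
  have P1_nonneg: "0 \<le> 2 * u * (u * \<beta> u)" for u
    using \<beta>_nonneg[of u] by (simp add: mult.assoc[symmetric])
  have "P1 (- a) \<le> P1 0"
  proof (rule DERIV_nonneg_imp_nondecreasing[of "- a" 0 P1])
    show "\<exists>y. (P1 has_real_derivative y) (at u) \<and> 0 \<le> y" for u
      using P1[of u] P1_nonneg[of u] by blast
  qed (use a in simp)
  also have "P1 0 < P1 a"
  proof (rule DERIV_pos_imp_increasing_open[OF a])
    show "\<exists>y. (P1 has_real_derivative y) (at u) \<and> 0 < y" if "0 < u" "u < a" for u
      using P1[of u] \<beta>_pos[of u] that by (intro exI[of _ "2 * u * (u * \<beta> u)"]) auto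
    show "continuous_on {0..a} P1"
      using DERIV_isCont[OF P1] by (simp add: continuous_at_imp_continuous_on)
  qed
  finally have d: "P1 (- a) < P1 a" .
  show thesis
  proof (rule that)
    fix A assume A: "P0 a - P0 (- a) < A"
    \<comment> \<open>h solves the linear equation that makes the area equal to A.\<close>
    define h where "h = (A - (P0 a - P0 (- a))) / (P1 a - P1 (- a))"
    have h: "0 < h" using A d by (simp add: h_def)
    define y where "y = (\<lambda>u. \<sigma> u + h * (u * \<beta> u))"
    define P where "P = (\<lambda>u. P0 u + h * P1 u)"
    have "closed_profile (P (sqrt (\<epsilon>/2)) - P (- sqrt (\<epsilon>/2))) \<epsilon>
      (\<lambda>t. P (sqrt (t - \<epsilon>/2))) (\<lambda>t. P (- sqrt (t - \<epsilon>/2))) (y 0)"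
    proof (rule closed_profile_from_curve[OF e])
      show "smooth_on y UNIV"
        unfolding y_def using C_on_id
        by (intro smooth_on_add smooth_on_mult smooth_on_const \<sigma>_smooth \<beta>_smooth) (auto simp: smooth_on_def)
      obtain \<beta>' where "(\<beta> has_real_derivative \<beta>') (at 0)"
        using smooth_on_deriv_real[OF _ \<beta>_smooth] by blast
      then show "(y has_real_derivative c * \<beta> 0 + h * \<beta> 0) (at 0)"
        unfolding y_def \<sigma>_def by (auto intro!: derivative_eq_intros S)
      \<comment> \<open>At 0 the step contributes c * \<beta> 0 and the bulge h * \<beta> 0 to the
        slope; both are positive, so the curve is regular at its closing point.\<close>
      have "0 < (c + h) * \<beta> 0" using c h \<beta>_pos[of 0] a by simp
      then show "c * \<beta> 0 + h * \<beta> 0 \<noteq> 0" by (simp add: distrib_right)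
      show "(P has_real_derivative 2 * u * y u) (at u)" for u
        unfolding P_def y_def by (auto intro!: derivative_eq_intros P0 P1 simp: algebra_simps)
      show "y u = 1" "y (- u) = 0" if "sqrt (\<epsilon>/2) \<le> u" for u
        using that \<sigma>1[of u] \<sigma>0[of u] \<beta>0[of u] \<beta>0[of "- u"] unfolding a_def[symmetric] y_def by auto
      show "y (- u) < y u" if "0 < u" for u
      proof (cases "u < a")
        case True
        then have "0 < h * (u * \<beta> u)" using h \<beta>_pos[of u] that by simp
        then show ?thesis using \<sigma>_mono[of "- u" u] that by (simp add: y_def \<beta>_even)
      next
        case False
        then show ?thesis using \<sigma>1[of u] \<sigma>0[of u] \<beta>0[of u] that by (simp add: y_def \<beta>_even)
      qed
    qed
    moreover have "P (sqrt (\<epsilon>/2)) - P (- sqrt (\<epsilon>/2)) = A"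
    proof -
      have "h * (P1 a - P1 (- a)) = A - (P0 a - P0 (- a))" using d by (simp add: h_def)
      then show ?thesis unfolding P_def a_def[symmetric] by (simp add: algebra_simps)
    qed
    ultimately show "\<exists>r s y. closed_profile A \<epsilon> r s y" by blast
  qed
qed

subsection \<open>Gradients\<close>

lemma grad_eq: "GDERIV f x :> D \<Longrightarrow> grad f x = D"
proof -
  assume D: "GDERIV f x :> D"
  have "D' = D" if "GDERIV f x :> D'" for D'
  proof -
    have "(\<lambda>h. h \<bullet> D') = (\<lambda>h. h \<bullet> D)"
      using has_derivative_unique that D unfolding gderiv_def by blast
    then have "h \<bullet> D' = h \<bullet> D" for h by meson
    then show "D' = D" by (metis vector_eq_ldot)
  qed
  with D show ?thesis unfolding grad_def by (rule the_equality)
qed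

definition C1 :: "('a::euclidean_space \<Rightarrow> real) \<Rightarrow> bool" where
  "C1 f \<longleftrightarrow> (\<forall>q. GDERIV f q :> grad f q) \<and> continuous_on UNIV (grad f)"

lemma C1I:
  assumes "\<And>q. GDERIV f q :> G q" "continuous_on UNIV G"
  shows "C1 f" "grad f = G"
proof -
  show "grad f = G" using grad_eq[OF assms(1)] by blast
  then show "C1 f" using assms unfolding C1_def by simp
qed

lemma C1_imp_continuous_on: "C1 f \<Longrightarrow> continuous_on UNIV f"
  unfolding C1_def gderiv_def by (metis has_derivative_continuous continuous_at_imp_continuous_on)

subsection \<open>Mollification\<close>

lemma lborel_integral_reflect:
  fixes g :: "'a::euclidean_space \<Rightarrow> real"
  assumes "g \<in> borel_measurable borel"
  shows "(LINT y|lborel. g (q - y)) = (LINT z|lborel. g z)"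
proof -
  have "lborel = distr lborel borel (\<lambda>y::'a. q - y)"
    using lborel_affine[of "-1" q] by (simp add: density_1)
  then have "(LINT z|lborel. g z) = (LINT z|distr lborel borel (\<lambda>y. q - y). g z)" by simp
  also have "\<dots> = (LINT y|lborel. g (q - y))"
    by (rule integral_distr) (use assms in auto)
  finally show ?thesis by simp
qed

lemma integrable_continuous_bounded_support:
  fixes h :: "'a::euclidean_space \<Rightarrow> real"
  assumes "continuous_on UNIV h" "\<And>y. y \<notin> cball a R \<Longrightarrow> h y = 0"
  shows "integrable lborel h"
proof -
  have "(\<lambda>x. indicator (cball a R) x *\<^sub>R h x) = h"
    using assms(2) by (auto simp: indicator_def fun_eq_iff)
  then show ?thesis
    using borel_integrable_compact[OF compact_cball continuous_on_subset[OF assms(1) subset_UNIV], of a R]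
    by simp
qed

text \<open>With integral zero the function would vanish almost everywhere; its zero set is closed,
  and a closed set of full measure is the whole space.\<close>

lemma integral_continuous_pos:
  fixes h :: "'a::euclidean_space \<Rightarrow> real"
  assumes h: "continuous_on UNIV h" "integrable lborel h" "\<And>y. 0 \<le> h y" "0 < h a"
  shows "0 < (LINT y|lborel. h y)"
proof (rule ccontr)
  assume "\<not> 0 < (LINT y|lborel. h y)"
  moreover have "0 \<le> (LINT y|lborel. h y)" using h(3) by simp
  ultimately have "(LINT y|lborel. h y) = 0" by simp
  then have "AE y in lborel. h y = 0"
    using integral_nonneg_eq_0_iff_AE[OF h(2)] h(3) by auto
  then have "AE y in lebesgue. y \<in> {y. h y = 0}" by (auto intro: AE_completion)
  moreover have "closed {y. h y = 0}"
    by (rule closed_Collect_eq) (use h(1) in auto)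
  ultimately have "a \<in> {y. h y = 0}" using mem_closed_if_AE_lebesgue by blast
  then show False using h(4) by simp
qed

section \<open>Smoothing kernels\<close>

lemma smoothing_kernelD:
  assumes "smoothing_kernel R \<rho>"
  shows "0 < R" "continuous_on UNIV \<rho>" "0 \<le> \<rho> y" "norm y < R \<Longrightarrow> 0 < \<rho> y" "R \<le> norm y \<Longrightarrow> \<rho> y = 0"
    "(LINT y|lborel. \<rho> y) = 1"
proof -
  show "0 < R" "continuous_on UNIV \<rho>" "0 \<le> \<rho> y" "(LINT y|lborel. \<rho> y) = 1"
    using assms smooth_on_imp_continuous_on by (auto simp: smoothing_kernel_def)
  have "\<rho> y \<noteq> 0 \<longleftrightarrow> norm y < R" using assms by (auto simp: smoothing_kernel_def set_eq_iff)
  then show "norm y < R \<Longrightarrow> 0 < \<rho> y" "R \<le> norm y \<Longrightarrow> \<rho> y = 0"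
    using \<open>0 \<le> \<rho> y\<close> by auto
qed

lemma kernel_integrable:
  assumes "smoothing_kernel R \<rho>" "continuous_on UNIV h"
  shows "integrable lborel (\<lambda>y. h y * \<rho> y)"
  by (rule integrable_continuous_bounded_support[of _ 0 R])
     (use smoothing_kernelD[OF assms(1)] assms(2) in \<open>auto intro!: continuous_intros\<close>)

lemma kernel_integral_mono:
  assumes "smoothing_kernel R \<rho>" "continuous_on UNIV f" "continuous_on UNIV g" "\<And>y. f y \<le> g y"
  shows "(LINT y|lborel. f y * \<rho> y) \<le> (LINT y|lborel. g y * \<rho> y)"
  by (rule integral_mono) (use kernel_integrable[OF assms(1)] assms smoothing_kernelD(3)[OF assms(1)]
      in \<open>auto intro: mult_right_mono\<close>)

lemma C_on_inner_self: "C_on k (\<lambda>y::'a::euclidean_space. y \<bullet> y) UNIV"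
proof (cases k)
  case 0
  then show ?thesis by (auto intro!: continuous_intros)
next
  case (Suc m)
  show ?thesis unfolding Suc
  proof (rule C_on_SucI)
    show "((\<lambda>y. y \<bullet> y) has_derivative (\<lambda>v. 2 * (x \<bullet> v))) (at x)" for x :: 'a
      by (auto intro!: derivative_eq_intros simp: inner_commute)
    show "C_on m (\<lambda>x. 2 * (x \<bullet> b)) UNIV" for b :: 'a
      by (intro C_on_bounded_linear bounded_linear_const_mult bounded_linear_inner_left) auto
  qed auto
qed

text \<open>A radial flat bump divided by its integral; radial symmetry gives the evenness that the
  separation of the surgeries relies on.\<close>

lemma even_smoothing_kernel_exists:
  obtains \<rho> :: "real^'n \<Rightarrow> real" where "smoothing_kernel 1 \<rho>" "\<And>y. \<rho> (- y) = \<rho> y"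
proof -
  define \<kappa> where "\<kappa> = (\<lambda>y::real^'n. flat 0 (1 + - 1 * (y \<bullet> y)))"
  have \<kappa>_smooth: "C_on k \<kappa> UNIV" for k
    unfolding \<kappa>_def
    by (intro C_on_compose[OF _ open_UNIV _ C_on_flat] C_on_add C_on_mult C_on_const C_on_inner_self) auto
  have \<kappa>_cont: "continuous_on UNIV \<kappa>" using \<kappa>_smooth[of 0] by simp
  have \<kappa>_pos: "0 < \<kappa> y \<longleftrightarrow> norm y < 1" for y
    by (simp add: \<kappa>_def flat_pos_iff power2_norm_eq_inner[symmetric] abs_square_less_1)
  have \<kappa>_nonneg: "0 \<le> \<kappa> y" for y by (simp add: \<kappa>_def flat_nonneg)
  have \<kappa>_zero: "\<kappa> y \<noteq> 0 \<longleftrightarrow> norm y < 1" for y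
    using \<kappa>_pos[of y] \<kappa>_nonneg[of y] by linarith
  have int: "integrable lborel \<kappa>"
    by (rule integrable_continuous_bounded_support[OF \<kappa>_cont, of 0 1]) (use \<kappa>_zero in force)
  define I where "I = (LINT y|lborel. \<kappa> y)"
  have I: "0 < I"
    unfolding I_def by (rule integral_continuous_pos[OF \<kappa>_cont int \<kappa>_nonneg, of 0]) (simp add: \<kappa>_pos)
  define \<rho> where "\<rho> = (\<lambda>y. \<kappa> y * inverse I)"
  have "smooth_on \<rho> UNIV"
    unfolding smooth_on_def \<rho>_def by (intro allI C_on_mult C_on_const \<kappa>_smooth) auto
  moreover have "(LINT y|lborel. \<rho> y) = 1"
    unfolding \<rho>_def using I by (simp add: I_def)
  moreover have "{y. \<rho> y \<noteq> 0} = ball 0 1"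
  proof (rule set_eqI)
    show "y \<in> {y. \<rho> y \<noteq> 0} \<longleftrightarrow> y \<in> ball 0 1" for y
      using \<kappa>_zero[of y] I by (simp add: \<rho>_def)
  qed
  moreover have "0 \<le> \<rho> y" for y using I \<kappa>_nonneg by (simp add: \<rho>_def)
  ultimately have "smoothing_kernel 1 \<rho>"
    unfolding smoothing_kernel_def by (intro conjI allI zero_less_one)
  moreover have "\<rho> (- y) = \<rho> y" for y by (simp add: \<rho>_def \<kappa>_def)
  ultimately show thesis by (rule that)
qed

lemma linear_eq_inner:
  fixes f :: "'a::euclidean_space \<Rightarrow> real"
  assumes "linear f"
  shows "f v = (\<Sum>b\<in>Basis. f b *\<^sub>R b) \<bullet> v"
proof -
  have "f v = f (\<Sum>b\<in>Basis. (v \<bullet> b) *\<^sub>R b)" by (simp only: euclidean_representation)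
  also have "\<dots> = (\<Sum>b\<in>Basis. f b *\<^sub>R b) \<bullet> v"
    by (simp add: linear_sum[OF assms] linear_scale[OF assms] inner_sum_left inner_commute[of v] mult.commute)
  finally show ?thesis .
qed

lemma kernel_gradient:
  assumes "smoothing_kernel R \<rho>"
  obtains G where "\<And>x. (\<rho> has_derivative (\<lambda>v. G x \<bullet> v)) (at x)" "continuous_on UNIV G"
proof -
  have "C_on (Suc 0) \<rho> UNIV" using assms by (simp only: smoothing_kernel_def smooth_on_def)
  then obtain d where d: "\<And>x. (\<rho> has_derivative d x) (at x)" "\<And>b. b \<in> Basis \<Longrightarrow> continuous_on UNIV (\<lambda>x. d x b)"
    by (elim C_on_SucE[OF open_UNIV]) auto
  define G where "G = (\<lambda>x. \<Sum>b\<in>Basis. d x b *\<^sub>R b)"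
  have "d x v = G x \<bullet> v" for x v
    unfolding G_def by (rule linear_eq_inner[OF has_derivative_linear[OF d(1)]])
  then have "d x = (\<lambda>v. G x \<bullet> v)" for x by blast
  then have "\<And>x. (\<rho> has_derivative (\<lambda>v. G x \<bullet> v)) (at x)" using d(1) by metis
  moreover have "continuous_on UNIV G"
    unfolding G_def by (intro continuous_intros d(2))
  ultimately show thesis by (rule that)
qed

text \<open>Reflecting the integration variable moves the dependence on q from \<phi>, which is only
  continuous, to the smooth kernel; then one differentiates under the integral.\<close>

lemma C1_convolution:
  fixes \<phi> :: "real^'n \<Rightarrow> real"
  assumes K: "smoothing_kernel R \<rho>" and \<phi>: "continuous_on UNIV \<phi>"
  shows "C1 (\<lambda>q. LINT y|lborel. \<phi> (q - y) * \<rho> y)" (is "C1 ?f")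
proof -
  obtain G where G: "\<And>x. (\<rho> has_derivative (\<lambda>v. G x \<bullet> v)) (at x)" "continuous_on UNIV G"
    using kernel_gradient[OF K] by blast
  note \<rho>_cont = smoothing_kernelD(2)[OF K]
  have loc: "\<exists>D. (\<forall>q\<in>ball q0 1. GDERIV ?f q :> D q) \<and> continuous_on (ball q0 1) D" for q0
  proof -
    \<comment> \<open>For q within distance 1 of q0 the integrand is supported in
      \<open>cball q0 (R + 1)\<close>, so a single box carries all these integrals and the Leibniz
      rule applies.\<close>
    obtain a b where ab: "cball q0 (R + 1) \<subseteq> cbox a b"
      using bounded_subset_cbox_symmetric[OF bounded_cball] by meson
    define F where "F = (\<lambda>q z. \<phi> z * \<rho> (q - z))"
    define F' where "F' = (\<lambda>q z. blinfun_inner_right (\<phi> z *\<^sub>R G (q - z)))"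
    have F_cont: "continuous_on UNIV (F q)" for q
      unfolding F_def by (intro continuous_intros \<phi> continuous_on_compose2[OF \<rho>_cont]) auto
    have f: "?f q = integral (cbox a b) (F q)" if q: "q \<in> ball q0 1" for q
    proof -
      have supp: "F q z = 0" if "z \<notin> cball q R" for z
        using smoothing_kernelD(5)[OF K, of "q - z"] that by (simp add: F_def dist_norm)
      have "z \<in> cball q0 (R + 1)" if "z \<in> cball q R" for z
        using that q dist_triangle[of q0 z q] by (simp add: dist_commute)
      then have "F q z = 0" if "z \<notin> cbox a b" for z
        using supp ab that by blast
      then have "F q = (\<lambda>z. if z \<in> cbox a b then F q z else 0)" by (simp add: fun_eq_iff)
      then have "integral UNIV (F q) = integral (cbox a b) (F q)"
        using integral_restrict_UNIV[of "cbox a b" "F q"] by simp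
      moreover have "integrable lborel (F q)"
        by (rule integrable_continuous_bounded_support[OF F_cont supp])
      ultimately have "(LINT z|lborel. F q z) = integral (cbox a b) (F q)"
        by (simp add: integral_lborel)
      moreover have "(LINT y|lborel. F q (q - y)) = (LINT z|lborel. F q z)"
        using F_cont by (intro lborel_integral_reflect borel_measurable_continuous_onI)
      ultimately show ?thesis by (simp add: F_def)
    qed
    have F'_cont: "continuous_on (U \<times> cbox a b) (\<lambda>(q, z). F' q z)" for U
      unfolding F'_def case_prod_beta
      by (intro bounded_linear.continuous_on[OF bounded_linear_blinfun_inner_right] continuous_intros
          continuous_on_compose2[OF \<phi>] continuous_on_compose2[OF G(2)]) auto
    define T where "T = (\<lambda>q. integral (cbox a b) (F' q))"
    define D where "D = (\<lambda>q. \<Sum>i\<in>Basis. blinfun_apply (T q) i *\<^sub>R i)"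
    have "continuous_on (ball q0 1) T"
      unfolding T_def by (rule integral_continuous_on_param[OF F'_cont])
    then have "continuous_on (ball q0 1) D"
      unfolding D_def by (intro continuous_intros)
    moreover have "GDERIV ?f q :> D q" if q: "q \<in> ball q0 1" for q
    proof -
      have "((\<lambda>q. integral (cbox a b) (F q)) has_derivative integral (cbox a b) (F' q)) (at q within ball q0 1)"
      proof (rule leibniz_rule[OF _ _ F'_cont q convex_ball])
        fix x z
        show "((\<lambda>x. F x z) has_derivative blinfun_apply (F' x z)) (at x within ball q0 1)"
          unfolding F_def F'_def
          by (rule has_derivative_at_withinI)
             (auto intro!: derivative_eq_intros has_derivative_compose[OF _ G(1)])
        show "F x integrable_on cbox a b"
          using continuous_on_subset[OF F_cont] by (intro integrable_continuous) auto
      qed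
      then have "((\<lambda>q. integral (cbox a b) (F q)) has_derivative blinfun_apply (T q)) (at q)"
        using q by (simp add: T_def at_within_open[OF _ open_ball])
      then have "(?f has_derivative blinfun_apply (T q)) (at q)"
        by (rule has_derivative_transform_within_open[OF _ open_ball q]) (use f in simp)
      moreover have "blinfun_apply (T q) v = v \<bullet> D q" for v
        unfolding D_def by (subst inner_commute)
          (rule linear_eq_inner[OF bounded_linear.linear[OF blinfun.bounded_linear_right]])
      ultimately show ?thesis unfolding gderiv_def by (rule has_derivative_eq_rhs[OF _ ext])
    qed
    ultimately show ?thesis by blast
  qed
  have "GDERIV ?f q :> grad ?f q" for q
  proof -
    obtain D where "\<forall>x\<in>ball q 1. GDERIV ?f x :> D x" using loc[of q] by blast
    then have D: "GDERIV ?f q :> D q" by simp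
    then show ?thesis by (simp only: grad_eq[OF D])
  qed
  moreover have "isCont (grad ?f) q" for q
  proof -
    obtain D where D: "\<forall>x\<in>ball q 1. GDERIV ?f x :> D x" "continuous_on (ball q 1) D"
      using loc[of q] by blast
    have "D x = grad ?f x" if "x \<in> ball q 1" for x
      using grad_eq[of ?f x "D x"] D(1) that by simp
    then have "continuous_on (ball q 1) (grad ?f)" by (rule continuous_on_eq[OF D(2)])
    then show ?thesis by (simp add: continuous_on_eq_continuous_at)
  qed
  ultimately show ?thesis unfolding C1_def by (simp add: continuous_at_imp_continuous_on)
qed

lemma C1_mollify:
  assumes "smoothing_kernel R \<rho>" "continuous_on UNIV \<phi>"
  shows "C1 (mollify \<rho> \<phi>)"
proof -
  let ?f = "\<lambda>q. LINT y|lborel. \<phi> (q - y) * \<rho> y"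
  have "GDERIV ?f q :> grad ?f q" "continuous_on UNIV (grad ?f)" for q
    using C1_convolution[OF assms] by (auto simp: C1_def)
  then show ?thesis
    using GDERIV_diff[OF _ GDERIV_const] unfolding mollify_def by (intro C1I(1)[of _ "grad ?f"]) fastforce+
qed

text \<open>By evenness of the kernel the average over \<open>y\<close> and \<open>- y\<close> may be taken first, and
  \<open>|a - b| + |a + b| \<ge> 2 |b|\<close>.\<close>

lemma convolution_abs_linear_ge:
  assumes K: "smoothing_kernel R \<rho>" and even: "\<And>y. \<rho> (- y) = \<rho> y"
  shows "(LINT y|lborel. \<bar>v \<bullet> y\<bar> * \<rho> y) \<le> (LINT y|lborel. \<bar>v \<bullet> (q - y)\<bar> * \<rho> y)"
proof -
  have c: "continuous_on UNIV (\<lambda>y. \<bar>v \<bullet> (q - y)\<bar>)" "continuous_on UNIV (\<lambda>y. \<bar>v \<bullet> (q + y)\<bar>)"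
    "continuous_on UNIV (\<lambda>y. 2 * \<bar>v \<bullet> y\<bar>)" "continuous_on UNIV (\<lambda>y. \<bar>v \<bullet> (q - y)\<bar> + \<bar>v \<bullet> (q + y)\<bar>)"
    by (intro continuous_intros)+
  have "(\<lambda>y. \<bar>v \<bullet> (q - y)\<bar> * \<rho> y) \<in> borel_measurable borel"
    using kernel_integrable[OF K c(1)] by auto
  from lborel_integral_reflect[OF this, of 0]
  have refl: "(LINT y|lborel. \<bar>v \<bullet> (q + y)\<bar> * \<rho> y) = (LINT y|lborel. \<bar>v \<bullet> (q - y)\<bar> * \<rho> y)"
    using even by simp
  have "(LINT y|lborel. 2 * \<bar>v \<bullet> y\<bar> * \<rho> y) \<le> (LINT y|lborel. (\<bar>v \<bullet> (q - y)\<bar> + \<bar>v \<bullet> (q + y)\<bar>) * \<rho> y)"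
    by (rule kernel_integral_mono[OF K c(3,4)]) (auto simp: inner_diff_right inner_add_right)
  also have "\<dots> = (LINT y|lborel. \<bar>v \<bullet> (q - y)\<bar> * \<rho> y) + (LINT y|lborel. \<bar>v \<bullet> (q + y)\<bar> * \<rho> y)"
    unfolding distrib_right by (intro Bochner_Integration.integral_add kernel_integrable[OF K] c)
  also have "(LINT y|lborel. 2 * \<bar>v \<bullet> y\<bar> * \<rho> y) = 2 * (LINT y|lborel. \<bar>v \<bullet> y\<bar> * \<rho> y)"
    by (simp add: mult.assoc)
  finally show ?thesis using refl by simp
qed

text \<open>The integrand is continuous and nonnegative, and it is positive at the multiple of v
  with norm R / 2, which lies inside the support ball.\<close>

lemma convolution_abs_linear_pos:
  assumes K: "smoothing_kernel R \<rho>" and v: "v \<noteq> 0"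
  shows "0 < (LINT y|lborel. \<bar>v \<bullet> y\<bar> * \<rho> y)"
proof (rule integral_continuous_pos)
  define y where "y = (R / 2 / norm v) *\<^sub>R v"
  have R: "0 < R" by (rule smoothing_kernelD(1)[OF K])
  have "norm y < R" using v R by (simp add: y_def)
  moreover have "v \<bullet> y \<noteq> 0" using v R by (simp add: y_def)
  ultimately show "0 < \<bar>v \<bullet> y\<bar> * \<rho> y" using smoothing_kernelD(4)[OF K] by simp
  show "continuous_on UNIV (\<lambda>y. \<bar>v \<bullet> y\<bar> * \<rho> y)"
    by (intro continuous_intros smoothing_kernelD(2)[OF K])
  show "integrable lborel (\<lambda>y. \<bar>v \<bullet> y\<bar> * \<rho> y)"
    by (rule kernel_integrable[OF K]) (intro continuous_intros)
qed (use smoothing_kernelD(3)[OF K] in simp)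

subsection \<open>Support functions and edge functions\<close>

lemma phi_white_ge:
  assumes "compact \<Delta>" "p \<in> \<Delta>"
  shows "p \<bullet> q \<le> phi_white \<Delta> q"
proof -
  have "compact ((\<lambda>p. p \<bullet> q) ` \<Delta>)"
    by (intro compact_continuous_image continuous_intros assms)
  then show ?thesis
    unfolding phi_white_def using assms by (intro cSUP_upper bounded_imp_bdd_above compact_imp_bounded)
qed

lemma phi_white_le: "\<Delta> \<noteq> {} \<Longrightarrow> (\<And>p. p \<in> \<Delta> \<Longrightarrow> p \<bullet> q \<le> b) \<Longrightarrow> phi_white \<Delta> q \<le> b"
  unfolding phi_white_def by (rule cSUP_least)

text \<open>Transfers continuity and convexity arguments from the maximum to the minimum.\<close>

lemma phi_black_eq: "phi_black \<Delta> q = - phi_white \<Delta> (- q)"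
  unfolding phi_black_def phi_white_def Inf_real_def by (simp add: image_image)

lemma phi_white_convex:
  assumes "compact \<Delta>" "\<Delta> \<noteq> {}"
  shows "convex_on UNIV (phi_white \<Delta>)"
proof (rule convex_onI)
  fix t :: real and x y assume t: "0 < t" "t < 1"
  show "phi_white \<Delta> ((1 - t) *\<^sub>R x + t *\<^sub>R y) \<le> (1 - t) * phi_white \<Delta> x + t * phi_white \<Delta> y"
  proof (rule phi_white_le[OF assms(2)])
    fix p assume p: "p \<in> \<Delta>"
    show "p \<bullet> ((1 - t) *\<^sub>R x + t *\<^sub>R y) \<le> (1 - t) * phi_white \<Delta> x + t * phi_white \<Delta> y"
      using t phi_white_ge[OF assms(1) p] by (auto simp: inner_add_right intro!: add_mono mult_left_mono)
  qed
qed simp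

lemma phi_white_continuous:
  assumes "compact \<Delta>" "\<Delta> \<noteq> {}"
  shows "continuous_on UNIV (phi_white \<Delta>)"
  by (rule convex_on_continuous[OF open_UNIV phi_white_convex[OF assms]])

lemma phi_black_continuous:
  assumes "compact \<Delta>" "\<Delta> \<noteq> {}"
  shows "continuous_on UNIV (phi_black \<Delta>)"
  unfolding phi_black_eq
  by (intro continuous_intros continuous_on_compose2[OF phi_white_continuous[OF assms]]) auto

text \<open>The counterpart of \<open>edge_fun\<close> before mollification. For an edge of the
  dimer graph it is a sum of two nonnegative terms, one per colour, and vanishes exactly on
  \<open>linearity_cone\<close>.\<close>

definition vertex_gap :: "'n dimer_edge \<Rightarrow> real^'n \<Rightarrow> real" where
  "vertex_gap e q = phi_white (white e) q - phi_black (black e) q - (wvert e - bvert e) \<bullet> q"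

lemma dimer_edgeD:
  assumes "dual_dimer B W" "e \<in> dimer_edges B W"
  shows "polytope (black e)" "polytope (white e)" "compact (black e)" "compact (white e)"
    "black e \<noteq> {}" "white e \<noteq> {}" "bvert e extreme_point_of black e" "wvert e extreme_point_of white e"
    "bvert e \<in> black e" "wvert e \<in> white e" "wvert e - bvert e \<in> lattice_points"
  using assms polytope_imp_compact
  by (auto simp: dual_dimer_def dimer_edges_def full_polytope_def extreme_point_of_def)

text \<open>One colour is compared with the candidate p; the term of the other colour is nonnegative
  because its chosen vertex is itself a candidate.\<close>

lemma vertex_gap_ge:
  assumes "dual_dimer B W" "e \<in> dimer_edges B W"
  shows "p \<in> white e \<Longrightarrow> (p - wvert e) \<bullet> q \<le> vertex_gap e q"
    and "p \<in> black e \<Longrightarrow> (bvert e - p) \<bullet> q \<le> vertex_gap e q"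
    and "0 \<le> vertex_gap e q"
proof -
  note e = dimer_edgeD[OF assms]
  have w: "p \<bullet> q \<le> phi_white (white e) q" if "p \<in> white e" for p
    by (rule phi_white_ge[OF e(4) that])
  have b: "phi_black (black e) q \<le> p \<bullet> q" if "p \<in> black e" for p
    using phi_white_ge[OF e(3) that, of "- q"] by (simp add: phi_black_eq)
  show "p \<in> white e \<Longrightarrow> (p - wvert e) \<bullet> q \<le> vertex_gap e q"
    "p \<in> black e \<Longrightarrow> (bvert e - p) \<bullet> q \<le> vertex_gap e q" "0 \<le> vertex_gap e q"
    using w[of p] w[OF e(10)] b[of p] b[OF e(9)] by (auto simp: vertex_gap_def inner_diff_left)
qed

lemma vertex_gap_continuous:
  assumes "dual_dimer B W" "e \<in> dimer_edges B W"
  shows "continuous_on UNIV (vertex_gap e)"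
  unfolding vertex_gap_def using dimer_edgeD[OF assms]
  by (intro continuous_intros phi_white_continuous phi_black_continuous)

lemma vertex_gap_convex:
  assumes "dual_dimer B W" "e \<in> dimer_edges B W" "0 \<le> t" "t \<le> 1"
  shows "vertex_gap e ((1 - t) *\<^sub>R x + t *\<^sub>R y) \<le> (1 - t) * vertex_gap e x + t * vertex_gap e y"
proof -
  note e = dimer_edgeD[OF assms(1,2)]
  have "phi_white (white e) ((1 - t) *\<^sub>R x + t *\<^sub>R y)
      \<le> (1 - t) * phi_white (white e) x + t * phi_white (white e) y"
    by (rule convex_onD[OF phi_white_convex]) (use e assms in auto)
  moreover have "phi_white (black e) ((1 - t) *\<^sub>R (- x) + t *\<^sub>R (- y))
      \<le> (1 - t) * phi_white (black e) (- x) + t * phi_white (black e) (- y)"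
    by (rule convex_onD[OF phi_white_convex]) (use e assms in auto)
  moreover have "(1 - t) *\<^sub>R (- x) + t *\<^sub>R (- y) = - ((1 - t) *\<^sub>R x + t *\<^sub>R y)" by simp
  ultimately show ?thesis
    by (simp add: vertex_gap_def phi_black_eq inner_add_right algebra_simps)
qed

text \<open>This gives the base point chosen in \<open>edge_fun\<close> its meaning. By the opposite
  edge directions, one ball of arguments makes both chosen vertices optimal.\<close>

lemma edge_region_nonempty:
  assumes "dual_dimer B W" "e \<in> dimer_edges B W"
  shows "edge_region R e \<noteq> {}"
proof -
  note e = dimer_edgeD[OF assms]
  have "wvert e - bvert e \<in> lattice_points" "white e \<in> W" "black e \<in> B"
    using assms(2) by (auto simp: dimer_edges_def)
  then have "edge_directions (black e) (bvert e) = uminus ` edge_directions (white e) (wvert e)"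
    using assms(1) e(7,8) unfolding dual_dimer_def by blast
  from opposite_edges_imp_common_linearity[OF e(1,7,2,8) this]
  obtain z where z: "\<And>u x. u \<in> ball z R \<Longrightarrow> x \<in> black e \<Longrightarrow> bvert e \<bullet> u \<le> x \<bullet> u"
    "\<And>u x. u \<in> ball z R \<Longrightarrow> x \<in> white e \<Longrightarrow> x \<bullet> u \<le> wvert e \<bullet> u"
    by blast
  have "u \<in> linearity_cone e" if u: "u \<in> ball z R" for u
  proof -
    have "phi_white (white e) u = wvert e \<bullet> u"
      by (intro antisym phi_white_le phi_white_ge e z(2)[OF u])
    moreover have "phi_white (black e) (- u) = bvert e \<bullet> (- u)"
      by (intro antisym phi_white_le phi_white_ge e) (use z(1)[OF u] in simp)
    ultimately show ?thesis by (simp add: linearity_cone_def phi_black_eq)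
  qed
  then show ?thesis unfolding edge_region_def by blast
qed

text \<open>The additive constants in \<open>mollify\<close> and \<open>edge_fun\<close> cancel.\<close>

lemma edge_fun_eq_convolution:
  assumes "dual_dimer B W" "e \<in> dimer_edges B W" and K: "smoothing_kernel (radius D) (kernel D)"
  shows "edge_fun D e q = (LINT y|lborel. vertex_gap e (q - y) * kernel D y)"
proof -
  define \<rho> where "\<rho> = kernel D"
  define m where "m = wvert e - bvert e"
  define cv where "cv = (\<lambda>g q. LINT y|lborel. g (q - y) * \<rho> y :: real)"
  note e = dimer_edgeD[OF assms(1,2)]
  have int: "integrable lborel (\<lambda>y. g (q - y) * \<rho> y)" if "continuous_on UNIV g" for g q
    unfolding \<rho>_def
    by (intro kernel_integrable[OF K] continuous_on_compose2[OF that] continuous_intros) auto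
  have iw: "integrable lborel (\<lambda>y. phi_white (white e) (q - y) * \<rho> y)"
    and ib: "integrable lborel (\<lambda>y. phi_black (black e) (q - y) * \<rho> y)"
    and im: "integrable lborel (\<lambda>y. m \<bullet> (q - y) * \<rho> y)" for q
    by (intro int phi_white_continuous phi_black_continuous continuous_intros e)+
  have i: "integrable lborel \<rho>" "integrable lborel (\<lambda>y. m \<bullet> y * \<rho> y)"
    using kernel_integrable[OF K, of "\<lambda>y. 1"]
      kernel_integrable[OF K linear_continuous_on[OF bounded_linear_inner_right[of m]]]
    unfolding \<rho>_def by simp_all
  \<comment> \<open>As the kernel has mass one, mollifying a linear function changes it only by a
    constant.\<close>
  have "cv (\<lambda>x. m \<bullet> x) q = m \<bullet> q * (LINT y|lborel. \<rho> y) - (LINT y|lborel. m \<bullet> y * \<rho> y)" for q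
    unfolding cv_def inner_diff_right left_diff_distrib using i by simp
  then have cm: "cv (\<lambda>x. m \<bullet> x) q = m \<bullet> q - (LINT y|lborel. m \<bullet> y * \<rho> y)" for q
    using smoothing_kernelD(6)[OF K] by (simp add: \<rho>_def)
  have "cv (vertex_gap e) q = cv (phi_white (white e)) q - cv (phi_black (black e)) q - cv (\<lambda>x. m \<bullet> x) q" for q
    unfolding cv_def vertex_gap_def m_def[symmetric] left_diff_distrib
    using iw ib im by (simp add: Bochner_Integration.integral_diff)
  then have gap: "edge_gap D e q = cv (vertex_gap e) q - cv (vertex_gap e) 0" for q
    unfolding edge_gap_def mollify_def m_def[symmetric] \<rho>_def[symmetric]
    using cm[of q] cm[of 0] by (simp add: cv_def)
  define q0 where "q0 = (SOME q0. q0 \<in> edge_region (radius D) e)"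
  have "q0 \<in> edge_region (radius D) e"
    unfolding q0_def using edge_region_nonempty[OF assms(1,2)] by (simp add: some_in_eq)
  \<comment> \<open>At the base point the integrand vanishes identically: within the radius the gap
    is zero, beyond it the kernel is.\<close>
  then have "vertex_gap e (q0 - y) * \<rho> y = 0" for y
  proof (cases "norm y < radius D")
    case True
    then have "q0 - y \<in> linearity_cone e"
      using \<open>q0 \<in> _\<close> unfolding edge_region_def by (auto simp: dist_norm)
    then show ?thesis by (simp add: linearity_cone_def vertex_gap_def inner_diff_left)
  next
    case False
    then show ?thesis using smoothing_kernelD(5)[OF K] by (simp add: \<rho>_def)
  qed
  then have "(\<lambda>y. vertex_gap e (q0 - y) * \<rho> y) = (\<lambda>y. 0)" by blast
  then have "cv (vertex_gap e) q0 = 0" unfolding cv_def by simp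
  then show ?thesis
    unfolding edge_fun_def q0_def[symmetric] gap by (simp add: cv_def \<rho>_def)
qed

lemma edge_fun_has_zero:
  assumes "dual_dimer B W" "e \<in> dimer_edges B W"
  obtains q0 where "edge_fun D e q0 = 0"
  by (rule that[of "SOME q0. q0 \<in> edge_region (radius D) e"]) (simp add: edge_fun_def)

text \<open>An average of translates of a convex function with nonnegative weights is
  convex.\<close>

lemma edge_fun_convex:
  assumes "dual_dimer B W" "e \<in> dimer_edges B W" and K: "smoothing_kernel (radius D) (kernel D)"
    and t: "0 \<le> t" "t \<le> 1"
  shows "edge_fun D e ((1 - t) *\<^sub>R x + t *\<^sub>R z) \<le> (1 - t) * edge_fun D e x + t * edge_fun D e z"
proof -
  note c = vertex_gap_continuous[OF assms(1,2)]
  have c': "continuous_on UNIV (\<lambda>y. vertex_gap e (h y))" if "continuous_on UNIV h" for h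
    by (rule continuous_on_compose2[OF c that]) auto
  have i: "integrable lborel (\<lambda>y. vertex_gap e (q - y) * kernel D y)" for q
    by (intro kernel_integrable[OF K] c' continuous_intros)
  have "(LINT y|lborel. vertex_gap e ((1 - t) *\<^sub>R x + t *\<^sub>R z - y) * kernel D y)
    \<le> (LINT y|lborel. ((1 - t) * vertex_gap e (x - y) + t * vertex_gap e (z - y)) * kernel D y)"
  proof (rule kernel_integral_mono[OF K])
    fix y
    have "(1 - t) *\<^sub>R x + t *\<^sub>R z - y = (1 - t) *\<^sub>R (x - y) + t *\<^sub>R (z - y)"
      by (simp add: algebra_simps)
    then show "vertex_gap e ((1 - t) *\<^sub>R x + t *\<^sub>R z - y)
        \<le> (1 - t) * vertex_gap e (x - y) + t * vertex_gap e (z - y)"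
      using vertex_gap_convex[OF assms(1,2) t] by simp
  qed (intro continuous_intros c')+
  also have "\<dots> = (1 - t) * (LINT y|lborel. vertex_gap e (x - y) * kernel D y)
      + t * (LINT y|lborel. vertex_gap e (z - y) * kernel D y)"
    unfolding distrib_right mult.assoc using i by simp
  finally show ?thesis by (simp only: edge_fun_eq_convolution[OF assms(1-3)])
qed

lemma C1_edge_fun:
  assumes "dual_dimer B W" "e \<in> dimer_edges B W" and K: "smoothing_kernel (radius D) (kernel D)"
  shows "C1 (edge_fun D e)"
proof -
  have "edge_fun D e = (\<lambda>q. LINT y|lborel. vertex_gap e (q - y) * kernel D y)"
    using edge_fun_eq_convolution[OF assms] by blast
  then show ?thesis using C1_convolution[OF K vertex_gap_continuous[OF assms(1,2)]] by simp
qed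

text \<open>A convex function that somewhere takes a smaller value has no critical point.\<close>

lemma grad_edge_fun_nonzero:
  assumes "dual_dimer B W" "e \<in> dimer_edges B W" and K: "smoothing_kernel (radius D) (kernel D)"
    and pos: "0 < edge_fun D e q"
  shows "grad (edge_fun D e) q \<noteq> 0"
proof
  let ?f = "edge_fun D e"
  assume 0: "grad ?f q = 0"
  obtain q0 where q0: "?f q0 = 0" using edge_fun_has_zero[OF assms(1,2)] by blast
  have "(?f has_derivative (\<lambda>h. 0)) (at q)"
    using C1_edge_fun[OF assms(1-3), unfolded C1_def gderiv_def, THEN conjunct1, rule_format, of q]
    by (simp add: 0)
  then have "(?f has_derivative (\<lambda>h. 0)) (at (q + 0 *\<^sub>R (q0 - q)))" by simp
  then have "((\<lambda>t. ?f (q + t *\<^sub>R (q0 - q))) has_derivative (\<lambda>h. 0)) (at (0::real))"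
    by (rule has_derivative_compose[rotated]) (auto intro!: derivative_eq_intros)
  then have "((\<lambda>t. ?f (q + t *\<^sub>R (q0 - q))) has_real_derivative 0) (at 0)"
    by (simp add: has_field_derivative_def flip: lambda_zero)
  then have "((\<lambda>h. (?f (q + h *\<^sub>R (q0 - q)) - ?f q) / h) \<longlongrightarrow> 0) (at_right 0)"
    unfolding DERIV_def by (auto intro: tendsto_within_subset)
  \<comment> \<open>Along the segment towards the zero q0, convexity bounds every difference
    quotient by the slope of the chord, - ?f q, which is negative.\<close>
  moreover have "eventually (\<lambda>h. (?f (q + h *\<^sub>R (q0 - q)) - ?f q) / h \<le> - ?f q) (at_right 0)"
    unfolding eventually_at_right_field
  proof (intro exI[of _ 1] conjI allI impI)
    fix h :: real assume h: "0 < h" "h < 1"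
    have "?f ((1 - h) *\<^sub>R q + h *\<^sub>R q0) \<le> (1 - h) * ?f q + h * ?f q0"
      by (rule edge_fun_convex[OF assms(1-3)]) (use h in auto)
    moreover have "(1 - h) *\<^sub>R q + h *\<^sub>R q0 = q + h *\<^sub>R (q0 - q)" by (simp add: algebra_simps)
    ultimately have "?f (q + h *\<^sub>R (q0 - q)) - ?f q \<le> - ?f q * h"
      using q0 by (simp add: algebra_simps)
    then show "(?f (q + h *\<^sub>R (q0 - q)) - ?f q) / h \<le> - ?f q" using h by (simp add: divide_le_eq)
  qed simp
  ultimately have "0 \<le> - ?f q" by (intro tendsto_upperbound) auto
  then show False using pos by simp
qed

text \<open>Mollified functions vanish at the origin, so the normalising constant of
  \<open>edge_fun\<close> can be read off as its value at 0. This is how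
  \<open>edge_fun D e 0\<close> enters the area condition.\<close>

lemma sphi_white_eq:
  "sphi_white D (white e) q =
    sphi_black D (black e) q + (wvert e - bvert e) \<bullet> q + edge_fun D e q - edge_fun D e 0"
  by (simp add: edge_fun_def edge_gap_def mollify_def)

section \<open>Separation of edges that meet the same polytope\<close>

lemma lattice_points_diff: "a \<in> lattice_points \<Longrightarrow> b \<in> lattice_points \<Longrightarrow> a - b \<in> lattice_points"
  by (simp add: lattice_points_def)

text \<open>If the vertices on the shared polytope coincided, those of the other colour would be
  congruent modulo the lattice; separation then identifies them together with their polytopes, and
  the edges would agree in every field.\<close>

lemma adjacent_vertices_differ:
  assumes dd: "dual_dimer B W" and e: "e \<in> dimer_edges B W" "e' \<in> dimer_edges B W" "e \<noteq> e'"
  shows "black e = black e' \<Longrightarrow> bvert e \<noteq> bvert e'" and "white e = white e' \<Longrightarrow> wvert e \<noteq> wvert e'"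
proof -
  have B: "separated_vertices B" and W: "separated_vertices W" using dd by (auto simp: dual_dimer_def)
  have mem: "black e \<in> B" "black e' \<in> B" "white e \<in> W" "white e' \<in> W"
    using e by (auto simp: dimer_edges_def)
  note d = dimer_edgeD[OF dd e(1)] and d' = dimer_edgeD[OF dd e(2)]
  show "bvert e \<noteq> bvert e'" if "black e = black e'"
  proof
    assume b: "bvert e = bvert e'"
    then have "wvert e - wvert e' \<in> lattice_points"
      using lattice_points_diff[OF d(11) d'(11)] by simp
    then have "(white e, wvert e) = (white e', wvert e')"
      using W mem d(8) d'(8) unfolding separated_vertices_def by blast
    then show False using e(3) that b by (simp add: dimer_edge.equality)
  qed
  show "wvert e \<noteq> wvert e'" if "white e = white e'"
  proof
    assume w: "wvert e = wvert e'"
    then have "bvert e - bvert e' \<in> lattice_points"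
      using lattice_points_diff[OF d'(11) d(11)] by simp
    then have "(black e, bvert e) = (black e', bvert e')"
      using B mem d(7) d'(7) unfolding separated_vertices_def by blast
    then show False using e(3) that w by (simp add: dimer_edge.equality)
  qed
qed

text \<open>v is the difference of the two vertices on the shared polytope. Each is a competitor for
  the other, so one gap bounds v \<bullet> q and the other bounds its negative.\<close>

lemma adjacent_vertex_gaps:
  assumes dd: "dual_dimer B W" and e: "e \<in> dimer_edges B W" "e' \<in> dimer_edges B W" "e \<noteq> e'"
    and adj: "black e = black e' \<or> white e = white e'"
  obtains v where "v \<noteq> 0" "\<And>q. \<bar>v \<bullet> q\<bar> \<le> vertex_gap e q + vertex_gap e' q"
proof -
  note d = dimer_edgeD[OF dd e(1)] and d' = dimer_edgeD[OF dd e(2)]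
  note g = vertex_gap_ge[OF dd e(1)] and g' = vertex_gap_ge[OF dd e(2)]
  from adj show thesis
  proof
    assume b: "black e = black e'"
    have "\<bar>(bvert e - bvert e') \<bullet> q\<bar> \<le> vertex_gap e q + vertex_gap e' q" for q
      using g(2)[of "bvert e'" q] g'(2)[of "bvert e" q] g(3)[of q] g'(3)[of q] d(9) d'(9) b
      by (simp add: inner_diff_left)
    then show thesis using that[of "bvert e - bvert e'"] adjacent_vertices_differ(1)[OF dd e b] by simp
  next
    assume w: "white e = white e'"
    have "\<bar>(wvert e - wvert e') \<bullet> q\<bar> \<le> vertex_gap e q + vertex_gap e' q" for q
      using g(1)[of "wvert e'" q] g'(1)[of "wvert e" q] g(3)[of q] g'(3)[of q] d(10) d'(10) w
      by (simp add: inner_diff_left)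
    then show thesis using that[of "wvert e - wvert e'"] adjacent_vertices_differ(2)[OF dd e w] by simp
  qed
qed

lemma adjacent_edge_funs_separated:
  assumes dd: "dual_dimer B W" and e: "e \<in> dimer_edges B W" "e' \<in> dimer_edges B W" "e \<noteq> e'"
    and adj: "black e = black e' \<or> white e = white e'"
    and K: "smoothing_kernel (radius D) (kernel D)" and even: "\<And>y. kernel D (- y) = kernel D y"
  shows "\<exists>\<delta>>0. \<forall>q. \<delta> \<le> edge_fun D e q + edge_fun D e' q"
proof -
  obtain v where v: "v \<noteq> 0" "\<And>q. \<bar>v \<bullet> q\<bar> \<le> vertex_gap e q + vertex_gap e' q"
    using adjacent_vertex_gaps[OF dd e adj] by blast
  have c: "continuous_on UNIV (\<lambda>y. vertex_gap a (q - y))" if "a \<in> dimer_edges B W" for a q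
    by (intro continuous_on_compose2[OF vertex_gap_continuous[OF dd that]] continuous_intros) auto
  show ?thesis
  proof (intro exI conjI allI)
    \<comment> \<open>The uniform bound is the value at the origin of the mollified function \<bar>v
      \<bullet> q\<bar>.\<close>
    show "0 < (LINT y|lborel. \<bar>v \<bullet> y\<bar> * kernel D y)" by (rule convolution_abs_linear_pos[OF K v(1)])
    fix q
    have "(LINT y|lborel. \<bar>v \<bullet> y\<bar> * kernel D y) \<le> (LINT y|lborel. \<bar>v \<bullet> (q - y)\<bar> * kernel D y)"
      by (rule convolution_abs_linear_ge[OF K even])
    also have "\<dots> \<le> (LINT y|lborel. (vertex_gap e (q - y) + vertex_gap e' (q - y)) * kernel D y)"
      by (rule kernel_integral_mono[OF K]) (use v(2) c e in \<open>auto intro!: continuous_intros\<close>)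
    also have "\<dots> = edge_fun D e q + edge_fun D e' q"
      unfolding distrib_right edge_fun_eq_convolution[OF dd e(1) K] edge_fun_eq_convolution[OF dd e(2) K]
      by (intro Bochner_Integration.integral_add kernel_integrable[OF K] c e)
    finally show "(LINT y|lborel. \<bar>v \<bullet> y\<bar> * kernel D y) \<le> edge_fun D e q + edge_fun D e' q" .
  qed
qed

lemma finite_dimer_edges:
  fixes B W :: "(real^'n) set set"
  assumes "dual_dimer B W"
  shows "finite (dimer_edges B W)"
proof -
  define V where "V = (\<lambda>C :: (real^'n) set set. \<Union>\<Delta>\<in>C. {v. v extreme_point_of \<Delta>})"
  have "finite (V B)" "finite (V W)" "finite B" "finite W"
    unfolding V_def using assms finite_extreme_points by (auto simp: dual_dimer_def full_polytope_def)
  then have "finite ((\<lambda>(b, w, v, u). \<lparr>black = b, white = w, bvert = v, wvert = u\<rparr>) ` (B \<times> W \<times> V B \<times> V W))"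
    by simp
  moreover have "dimer_edges B W \<subseteq>
    (\<lambda>(b, w, v, u). \<lparr>black = b, white = w, bvert = v, wvert = u\<rparr>) ` (B \<times> W \<times> V B \<times> V W)"
  proof
    fix e assume "e \<in> dimer_edges B W"
    then show "e \<in> (\<lambda>(b, w, v, u). \<lparr>black = b, white = w, bvert = v, wvert = u\<rparr>) ` (B \<times> W \<times> V B \<times> V W)"
      by (intro image_eqI[of _ _ "(black e, white e, bvert e, wvert e)"]) (auto simp: V_def dimer_edges_def)
  qed
  ultimately show ?thesis by (rule finite_subset[rotated])
qed

subsection \<open>Primitives on the dimer Lagrangian\<close>

text \<open>The differential of q \<bullet> p is q \<bullet> dp + p \<bullet> dq, and the hypothesis
  on \<Psi> cancels the second term. The free constant c is for matching primitives between
  patches.\<close>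

lemma legendre_within:
  assumes "(\<Psi> has_derivative (\<lambda>v. fst v \<bullet> snd x)) (at x within L)"
  shows "((\<lambda>x. fst x \<bullet> snd x - \<Psi> x + c) has_derivative eta x) (at x within L)"
proof -
  have "((\<lambda>x. fst x \<bullet> snd x - \<Psi> x + c) has_derivative
      (\<lambda>v. fst x \<bullet> snd v + fst v \<bullet> snd x - fst v \<bullet> snd x + 0)) (at x within L)"
    by (intro derivative_intros assms bounded_linear_imp_has_derivative bounded_linear_fst bounded_linear_snd)
  then show ?thesis by (simp add: eta_def[abs_def])
qed

lemma legendre_gderiv:
  assumes "GDERIV \<Phi> (fst x) :> snd x"
  shows "((\<lambda>x. fst x \<bullet> snd x - \<Phi> (fst x) + c) has_derivative eta x) (at x within L)"
proof (rule legendre_within)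
  show "((\<lambda>x. \<Phi> (fst x)) has_derivative (\<lambda>v. fst v \<bullet> snd x)) (at x within L)"
    by (rule has_derivative_compose[OF bounded_linear_imp_has_derivative[OF bounded_linear_fst]
          assms[unfolded gderiv_def]])
qed

text \<open>Both difference quotients have the same limit, so the selection P may oscillate near x.
  It is meant for closing points, where the two branches of a neck meet.\<close>

lemma has_derivative_either:
  assumes "(g has_derivative d) (at x within L)" "(h has_derivative d) (at x within L)" "g x = h x"
  shows "((\<lambda>y. if P y then g y else h y) has_derivative d) (at x within L)"
proof -
  let ?k = "\<lambda>y. if P y then g y else h y"
  let ?Q = "\<lambda>g y. (1 / norm (y - x)) *\<^sub>R (g y - (g x + d (y - x)))"
  have "bounded_linear d" "(?Q g \<longlongrightarrow> 0) (at x within L)" "(?Q h \<longlongrightarrow> 0) (at x within L)"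
    using assms by (auto simp: has_derivative_within)
  moreover have "?Q ?k = (\<lambda>y. if P y then ?Q g y else ?Q h y)"
    using assms(3) by (auto simp: fun_eq_iff)
  ultimately show ?thesis
    unfolding has_derivative_within by (auto intro!: filterlim_If intro: tendsto_mono[OF inf_le1])
qed

text \<open>The modulus of each coordinate is the exponential of the base coordinate.\<close>

lemma covering_eq_imp_fst_eq: "covering x = covering y \<Longrightarrow> fst x = fst y"
proof -
  assume c: "covering x = covering y"
  have "fst x $ i = fst y $ i" for i
  proof -
    have "exp (Complex (fst x $ i) (2 * pi * snd x $ i)) = exp (Complex (fst y $ i) (2 * pi * snd y $ i))"
      using c unfolding covering_def vec_eq_iff by simp
    then have "norm (exp (Complex (fst x $ i) (2 * pi * snd x $ i)))
        = norm (exp (Complex (fst y $ i) (2 * pi * snd y $ i)))" by (rule arg_cong)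
    then show ?thesis by (simp only: norm_exp_eq_Re exp_inj_iff complex.sel)
  qed
  then show ?thesis by (simp add: vec_eq_iff)
qed

lemma GDERIV_compose_real:
  assumes "C1 f" "(h has_real_derivative h') (at (f q))"
  shows "GDERIV (\<lambda>x. h (f x)) q :> h' *\<^sub>R grad f q"
  using GDERIV_DERIV_compose[of f q "grad f q" h h'] assms by (simp add: C1_def)

lemma GDERIV_sum:
  assumes "\<And>i. i \<in> I \<Longrightarrow> GDERIV (f i) q :> G i"
  shows "GDERIV (\<lambda>x. \<Sum>i\<in>I. f i x) q :> (\<Sum>i\<in>I. G i)"
  using assms has_derivative_sum[of I f "\<lambda>i h. h \<bullet> G i"] by (simp add: gderiv_def inner_sum_right)

lemma cutoff_sum_eq:
  assumes "finite I" "e \<in> I" "\<And>e'. e' \<in> I \<Longrightarrow> e' \<noteq> e \<Longrightarrow> h e' = 0"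
  shows "(\<Sum>i\<in>I. h i) = h e"
  using sum.remove[OF assms(1,2), of h] sum.neutral[of "I - {e}" h] assms(3) by simp

lemma closed_profileD:
  assumes "closed_profile A \<epsilon> r s y"
  shows "0 < \<epsilon>" "r \<epsilon> - s \<epsilon> = A" "r (\<epsilon>/2) = s (\<epsilon>/2)"
    "(deriv r \<longlongrightarrow> y) (at_right (\<epsilon>/2))" "(deriv s \<longlongrightarrow> y) (at_right (\<epsilon>/2))"
    "(r has_real_derivative y) (at (\<epsilon>/2) within {\<epsilon>/2..})"
    "(s has_real_derivative y) (at (\<epsilon>/2) within {\<epsilon>/2..})"
    "\<epsilon>/2 < t \<Longrightarrow> deriv s t < deriv r t"
    "\<epsilon>/2 < t \<Longrightarrow> (r has_real_derivative deriv r t) (at t)"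
    "\<epsilon>/2 < t \<Longrightarrow> (s has_real_derivative deriv s t) (at t)"
    "continuous_on {\<epsilon>/2<..} (deriv r)" "continuous_on {\<epsilon>/2<..} (deriv s)"
    "\<epsilon> \<le> t \<Longrightarrow> deriv r t = 1" "\<epsilon> \<le> t \<Longrightarrow> deriv s t = 0"
  using assms smooth_on_deriv_real[of "{\<epsilon>/2<..}"] smooth_on_deriv_continuous[of "{\<epsilon>/2<..}"]
  unfolding closed_profile_def profile_pair_def by auto

text \<open>Beyond the width the profile slopes are the constants 1 and 0, so surgery alters the
  sections' potentials there only by constants.\<close>

lemma closed_profile_ends:
  assumes "closed_profile A \<epsilon> r s y" "\<epsilon> \<le> t"
  shows "r t - t = r \<epsilon> - \<epsilon>" "s t = s \<epsilon>"
proof -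
  note c = closed_profileD[OF assms(1)]
  have "r t - t = r \<epsilon> - \<epsilon> \<and> s t = s \<epsilon>"
  proof (cases "\<epsilon> = t")
    case False
    then have lt: "\<epsilon> < t" using assms(2) by simp
    have r: "((\<lambda>t. r t - t) has_real_derivative 0) (at u)" and s: "(s has_real_derivative 0) (at u)"
      if "\<epsilon> \<le> u" for u
    proof -
      have u: "\<epsilon>/2 < u" using that c(1) by simp
      show "((\<lambda>t. r t - t) has_real_derivative 0) (at u)"
        using DERIV_diff[OF c(9)[OF u] DERIV_ident] c(13)[OF that] by simp
      show "(s has_real_derivative 0) (at u)"
        using c(10)[OF u] c(14)[OF that] by simp
    qed
    have "continuous_on {\<epsilon>..t} (\<lambda>t. r t - t)" "continuous_on {\<epsilon>..t} s"
      using DERIV_isCont[OF r] DERIV_isCont[OF s] by (auto intro!: continuous_at_imp_continuous_on)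
    then show ?thesis
      using DERIV_isconst_end[OF lt, of "\<lambda>t. r t - t"] DERIV_isconst_end[OF lt, of s] r s by auto
  qed simp
  then show "r t - t = r \<epsilon> - \<epsilon>" "s t = s \<epsilon>" by auto
qed

text \<open>The enclosed area is prescribed so that the jump between black and white primitives is
  the same C at every edge; then no cycle of the graph carries a period. \<open>y0 e\<close> is the
  height of the closing point.\<close>

locale dimer_surgery =
  fixes B W :: "(real^'n) set set" and D :: "'n surgery" and C :: real and y0 :: "'n dimer_edge \<Rightarrow> real"
  assumes dd: "dual_dimer B W" and sd: "surgery_data B W D"
    and prof: "e \<in> dimer_edges B W \<Longrightarrow>
      closed_profile (width D e + C - edge_fun D e 0) (width D e) (r_prof D e) (s_prof D e) (y0 e)"
begin

lemma kernel: "smoothing_kernel (radius D) (kernel D)"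
  using sd by (simp add: surgery_data_def)

lemmas profD = closed_profileD[OF prof] and prof_ends = closed_profile_ends[OF prof]

lemma C1_f: "e \<in> dimer_edges B W \<Longrightarrow> C1 (edge_fun D e)"
  by (rule C1_edge_fun[OF dd _ kernel])

lemma C1_black: "\<Delta> \<in> B \<Longrightarrow> C1 (sphi_black D \<Delta>)"
  and C1_white: "\<Delta> \<in> W \<Longrightarrow> C1 (sphi_white D \<Delta>)"
proof -
  have "compact \<Delta> \<and> \<Delta> \<noteq> {}" if "\<Delta> \<in> B \<union> W" for \<Delta>
  proof -
    have "full_polytope \<Delta>" using dd that by (auto simp: dual_dimer_def)
    then show ?thesis by (auto simp: full_polytope_def polytope_imp_compact)
  qed
  then show "\<Delta> \<in> B \<Longrightarrow> C1 (sphi_black D \<Delta>)" "\<Delta> \<in> W \<Longrightarrow> C1 (sphi_white D \<Delta>)"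
    by (auto intro!: C1_mollify[OF kernel] phi_black_continuous phi_white_continuous)
qed

lemma edge_black: "e \<in> dimer_edges B W \<Longrightarrow> black e \<in> B" and edge_white: "e \<in> dimer_edges B W \<Longrightarrow> white e \<in> W"
  by (auto simp: dimer_edges_def)

section \<open>Potentials of the black and white sheets after surgery\<close>

lemma far_from_others:
  assumes "e \<in> dimer_edges B W" "e' \<in> dimer_edges B W" "e' \<noteq> e" "black e = black e' \<or> white e = white e'"
    and "edge_fun D e q \<le> width D e"
  shows "width D e' < edge_fun D e' q"
proof (rule ccontr)
  assume "\<not> width D e' < edge_fun D e' q"
  then have "q \<in> {q. edge_fun D e q \<le> width D e} \<inter> {q. edge_fun D e' q \<le> width D e'}"
    using assms(5) by simp
  moreover have "{q. edge_fun D e q \<le> width D e} \<inter> {q. edge_fun D e' q \<le> width D e'} = {}"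
    using sd assms(1-4) unfolding surgery_data_def by blast
  ultimately show False by blast
qed

text \<open>The covector of a branch with profile h. Unlike the gradient of the composed potential,
  this expression separates the factors whose limits at the closing points are known.\<close>

definition slope :: "(real \<Rightarrow> real) \<Rightarrow> 'n dimer_edge \<Rightarrow> real^'n \<Rightarrow> real^'n" where
  "slope h e q = grad (sphi_black D (black e)) q + deriv h (edge_fun D e q) *\<^sub>R grad (edge_fun D e) q"

lemma grad_branch:
  assumes e: "e \<in> dimer_edges B W" and q: "q \<in> neck_base D e"
  shows "grad (\<lambda>x. sphi_black D (black e) x + s_prof D e (edge_fun D e x)) q = slope (s_prof D e) e q"
    and "grad (\<lambda>x. sphi_black D (black e) x + r_prof D e (edge_fun D e x)) q = slope (r_prof D e) e q"
proof -
  have q: "width D e / 2 < edge_fun D e q" using q by (simp add: neck_base_def)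
  have b: "GDERIV (sphi_black D (black e)) q :> grad (sphi_black D (black e)) q"
    using C1_black[OF edge_black[OF e]] by (simp add: C1_def)
  show "grad (\<lambda>x. sphi_black D (black e) x + s_prof D e (edge_fun D e x)) q = slope (s_prof D e) e q"
    "grad (\<lambda>x. sphi_black D (black e) x + r_prof D e (edge_fun D e x)) q = slope (r_prof D e) e q"
    unfolding slope_def
    by (intro grad_eq GDERIV_add b GDERIV_compose_real C1_f e profD(9,10)[OF e q])+
qed

lemma black_branch_eq: "e \<in> dimer_edges B W \<Longrightarrow>
    black_branch D e = (\<lambda>q. (q, slope (s_prof D e) e q)) ` neck_base D e"
  and white_branch_eq: "e \<in> dimer_edges B W \<Longrightarrow>
    white_branch D e = (\<lambda>q. (q, slope (r_prof D e) e q)) ` neck_base D e"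
  unfolding black_branch_def white_branch_def by (auto intro!: image_cong simp: grad_branch)

text \<open>Each correction is normalised to vanish beyond the width of its edge, so one formula
  serves the whole sheet: there it is the section's potential, and near a neck the branch potential
  up to a constant.\<close>

definition black_potential :: "(real^'n) set \<Rightarrow> real^'n \<Rightarrow> real" where
  "black_potential \<Delta> q = sphi_black D \<Delta> q +
     (\<Sum>e\<in>{e \<in> dimer_edges B W. black e = \<Delta>}. s_prof D e (edge_fun D e q) - s_prof D e (width D e))"

text \<open>The white section corresponds to the profile r t = t, so the correction is the deviation
  r t - t, again normalised to vanish beyond the width.\<close>

definition white_potential :: "(real^'n) set \<Rightarrow> real^'n \<Rightarrow> real" where
  "white_potential \<Delta> q = sphi_white D \<Delta> q +
     (\<Sum>e\<in>{e \<in> dimer_edges B W. white e = \<Delta>}.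
        (r_prof D e (edge_fun D e q) - edge_fun D e q) - (r_prof D e (width D e) - width D e))"

lemma GDERIV_black_potential:
  assumes "\<Delta> \<in> B" and "\<And>e. e \<in> dimer_edges B W \<Longrightarrow> black e = \<Delta> \<Longrightarrow> width D e / 2 < edge_fun D e q"
  shows "GDERIV (black_potential \<Delta>) q :> grad (sphi_black D \<Delta>) q +
    (\<Sum>e\<in>{e \<in> dimer_edges B W. black e = \<Delta>}. deriv (s_prof D e) (edge_fun D e q) *\<^sub>R grad (edge_fun D e) q)"
proof -
  have "GDERIV (sphi_black D \<Delta>) q :> grad (sphi_black D \<Delta>) q"
    using C1_black[OF assms(1)] by (simp add: C1_def)
  moreover have "GDERIV (\<lambda>q. s_prof D e (edge_fun D e q) - s_prof D e (width D e)) q :>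
      deriv (s_prof D e) (edge_fun D e q) *\<^sub>R grad (edge_fun D e) q"
    if e: "e \<in> {e \<in> dimer_edges B W. black e = \<Delta>}" for e
  proof -
    have "(s_prof D e has_real_derivative deriv (s_prof D e) (edge_fun D e q)) (at (edge_fun D e q))"
      using e profD(10)[OF _ assms(2)] by blast
    then show ?thesis
      using GDERIV_diff[OF GDERIV_compose_real[OF C1_f] GDERIV_const] e by fastforce
  qed
  ultimately show ?thesis
    unfolding black_potential_def by (intro GDERIV_add GDERIV_sum) auto
qed

lemma GDERIV_white_potential:
  assumes "\<Delta> \<in> W" and "\<And>e. e \<in> dimer_edges B W \<Longrightarrow> white e = \<Delta> \<Longrightarrow> width D e / 2 < edge_fun D e q"
  shows "GDERIV (white_potential \<Delta>) q :> grad (sphi_white D \<Delta>) q +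
    (\<Sum>e\<in>{e \<in> dimer_edges B W. white e = \<Delta>}. (deriv (r_prof D e) (edge_fun D e q) - 1) *\<^sub>R grad (edge_fun D e) q)"
proof -
  have "GDERIV (sphi_white D \<Delta>) q :> grad (sphi_white D \<Delta>) q"
    using C1_white[OF assms(1)] by (simp add: C1_def)
  moreover have "GDERIV (\<lambda>q. (r_prof D e (edge_fun D e q) - edge_fun D e q) - (r_prof D e (width D e) - width D e)) q :>
      (deriv (r_prof D e) (edge_fun D e q) - 1) *\<^sub>R grad (edge_fun D e) q"
    if e: "e \<in> {e \<in> dimer_edges B W. white e = \<Delta>}" for e
  proof -
    have "((\<lambda>t. r_prof D e t - t) has_real_derivative deriv (r_prof D e) (edge_fun D e q) - 1) (at (edge_fun D e q))"
      by (intro DERIV_diff DERIV_ident) (use e profD(9)[OF _ assms(2)] in blast)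
    then show ?thesis
      using GDERIV_diff[OF GDERIV_compose_real[OF C1_f, of _ "\<lambda>t. r_prof D e t - t"] GDERIV_const] e by fastforce
  qed
  ultimately show ?thesis
    unfolding white_potential_def by (intro GDERIV_add GDERIV_sum) auto
qed

lemma width_pos: "e \<in> dimer_edges B W \<Longrightarrow> 0 < width D e"
  using profD(1) by blast

text \<open>Over the neck of e all other edges at the same polytope are beyond their widths by
  disjointness; their corrections and the derivatives of these vanish.\<close>

lemma black_potential_near:
  assumes e: "e \<in> dimer_edges B W" and q: "q \<in> neck_base D e"
  shows "black_potential (black e) q =
      sphi_black D (black e) q + s_prof D e (edge_fun D e q) - s_prof D e (width D e)"
    and "GDERIV (black_potential (black e)) q :> slope (s_prof D e) e q"
proof -
  let ?I = "{e' \<in> dimer_edges B W. black e' = black e}"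
  have fin: "finite ?I" using finite_dimer_edges[OF dd] by simp
  have far: "width D e' < edge_fun D e' q" if "e' \<in> ?I" "e' \<noteq> e" for e'
    using far_from_others[OF e _ that(2)] that(1) q by (simp add: neck_base_def)
  have "(\<Sum>e\<in>?I. s_prof D e (edge_fun D e q) - s_prof D e (width D e))
      = s_prof D e (edge_fun D e q) - s_prof D e (width D e)"
  proof (rule cutoff_sum_eq[OF fin])
    fix e' assume e': "e' \<in> ?I" "e' \<noteq> e"
    have "s_prof D e' (edge_fun D e' q) = s_prof D e' (width D e')"
      by (rule prof_ends(2)) (use e' far[OF e'] in auto)
    then show "s_prof D e' (edge_fun D e' q) - s_prof D e' (width D e') = 0" by simp
  qed (use e in simp)
  then show "black_potential (black e) q =
      sphi_black D (black e) q + s_prof D e (edge_fun D e q) - s_prof D e (width D e)"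
    by (simp add: black_potential_def)
  have half: "width D e' / 2 < edge_fun D e' q" if "e' \<in> dimer_edges B W" "black e' = black e" for e'
    using far[of e'] that q width_pos[OF that(1)] by (cases "e' = e") (auto simp: neck_base_def)
  have "(\<Sum>e\<in>?I. deriv (s_prof D e) (edge_fun D e q) *\<^sub>R grad (edge_fun D e) q)
      = deriv (s_prof D e) (edge_fun D e q) *\<^sub>R grad (edge_fun D e) q"
    by (rule cutoff_sum_eq[OF fin]) (use e far profD(14) in \<open>auto simp: less_imp_le\<close>)
  then show "GDERIV (black_potential (black e)) q :> slope (s_prof D e) e q"
    using GDERIV_black_potential[OF edge_black[OF e] half] by (simp add: slope_def)
qed

lemma grad_white:
  assumes e: "e \<in> dimer_edges B W"
  shows "grad (sphi_white D (white e)) q =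
    grad (sphi_black D (black e)) q + (wvert e - bvert e) + grad (edge_fun D e) q"
proof (rule grad_eq)
  have "GDERIV (\<lambda>q. (wvert e - bvert e) \<bullet> q) q :> wvert e - bvert e"
    unfolding gderiv_def by (auto intro!: derivative_eq_intros simp: inner_commute)
  then have "GDERIV (\<lambda>q. sphi_black D (black e) q + (wvert e - bvert e) \<bullet> q + edge_fun D e q - edge_fun D e 0) q :>
    grad (sphi_black D (black e)) q + (wvert e - bvert e) + grad (edge_fun D e) q - 0"
    using C1_black[OF edge_black[OF e]] C1_f[OF e]
    by (intro GDERIV_diff GDERIV_add GDERIV_const) (auto simp: C1_def)
  then show "GDERIV (sphi_white D (white e)) q :>
    grad (sphi_black D (black e)) q + (wvert e - bvert e) + grad (edge_fun D e) q"
    unfolding sphi_white_eq[abs_def] by simp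
qed

text \<open>As on the black side only the term of e survives; the extra covector
  \<open>wvert e - bvert e\<close> is the change of lift between the white section and the
  neck.\<close>

lemma white_potential_near:
  assumes e: "e \<in> dimer_edges B W" and q: "q \<in> neck_base D e"
  shows "white_potential (white e) q = sphi_white D (white e) q +
      (r_prof D e (edge_fun D e q) - edge_fun D e q) - (r_prof D e (width D e) - width D e)"
    and "GDERIV (white_potential (white e)) q :> slope (r_prof D e) e q + (wvert e - bvert e)"
proof -
  let ?I = "{e' \<in> dimer_edges B W. white e' = white e}"
  have fin: "finite ?I" using finite_dimer_edges[OF dd] by simp
  have far: "width D e' < edge_fun D e' q" if "e' \<in> ?I" "e' \<noteq> e" for e'
    using far_from_others[OF e _ that(2)] that(1) q by (simp add: neck_base_def)
  have "(\<Sum>e\<in>?I. (r_prof D e (edge_fun D e q) - edge_fun D e q) - (r_prof D e (width D e) - width D e))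
      = (r_prof D e (edge_fun D e q) - edge_fun D e q) - (r_prof D e (width D e) - width D e)"
  proof (rule cutoff_sum_eq[OF fin])
    fix e' assume e': "e' \<in> ?I" "e' \<noteq> e"
    have "r_prof D e' (edge_fun D e' q) - edge_fun D e' q = r_prof D e' (width D e') - width D e'"
      by (rule prof_ends(1)) (use e' far[OF e'] in auto)
    then show "(r_prof D e' (edge_fun D e' q) - edge_fun D e' q) - (r_prof D e' (width D e') - width D e') = 0"
      by simp
  qed (use e in simp)
  then show "white_potential (white e) q = sphi_white D (white e) q +
      (r_prof D e (edge_fun D e q) - edge_fun D e q) - (r_prof D e (width D e) - width D e)"
    by (simp add: white_potential_def)
  have half: "width D e' / 2 < edge_fun D e' q" if "e' \<in> dimer_edges B W" "white e' = white e" for e'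
    using far[of e'] that q width_pos[OF that(1)] by (cases "e' = e") (auto simp: neck_base_def)
  have sum: "(\<Sum>e\<in>?I. (deriv (r_prof D e) (edge_fun D e q) - 1) *\<^sub>R grad (edge_fun D e) q)
      = (deriv (r_prof D e) (edge_fun D e q) - 1) *\<^sub>R grad (edge_fun D e) q"
    by (rule cutoff_sum_eq[OF fin]) (use e far profD(13) in \<open>auto simp: less_imp_le\<close>)
  show "GDERIV (white_potential (white e)) q :> slope (r_prof D e) e q + (wvert e - bvert e)"
    using GDERIV_white_potential[OF edge_white[OF e] half, unfolded sum grad_white[OF e]]
    by (simp add: slope_def algebra_simps)
qed

lemma black_sheet_gderiv:
  assumes \<Delta>: "\<Delta> \<in> B" and x: "x \<in> black_sheet B W D \<Delta>"
  shows "GDERIV (black_potential \<Delta>) (fst x) :> snd x"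
  using x unfolding black_sheet_def
proof (elim UnE)
  assume "x \<in> {(q, grad (sphi_black D \<Delta>) q) | q.
    \<forall>e\<in>dimer_edges B W. black e = \<Delta> \<longrightarrow> width D e \<le> edge_fun D e q}"
  then obtain q where q: "x = (q, grad (sphi_black D \<Delta>) q)"
    "\<And>e. e \<in> dimer_edges B W \<Longrightarrow> black e = \<Delta> \<Longrightarrow> width D e \<le> edge_fun D e q" by blast
  have "width D e / 2 < edge_fun D e q" if "e \<in> dimer_edges B W" "black e = \<Delta>" for e
    using q(2)[OF that] width_pos[OF that(1)] by simp
  from GDERIV_black_potential[OF \<Delta> this] show ?thesis
    using profD(14)[OF _ q(2)] by (simp add: q(1))
next
  assume "x \<in> (\<Union>e\<in>{e \<in> dimer_edges B W. black e = \<Delta>}. black_branch D e)"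
  then show ?thesis using black_potential_near(2) by (auto simp: black_branch_eq)
qed

lemma white_sheet_gderiv:
  assumes \<Delta>: "\<Delta> \<in> W" and x: "x \<in> white_sheet B W D \<Delta>"
  shows "GDERIV (white_potential \<Delta>) (fst x) :> snd x"
  using x unfolding white_sheet_def
proof (elim UnE)
  assume "x \<in> {(q, grad (sphi_white D \<Delta>) q) | q.
    \<forall>e\<in>dimer_edges B W. white e = \<Delta> \<longrightarrow> width D e \<le> edge_fun D e q}"
  then obtain q where q: "x = (q, grad (sphi_white D \<Delta>) q)"
    "\<And>e. e \<in> dimer_edges B W \<Longrightarrow> white e = \<Delta> \<Longrightarrow> width D e \<le> edge_fun D e q" by blast
  have "width D e / 2 < edge_fun D e q" if "e \<in> dimer_edges B W" "white e = \<Delta>" for e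
    using q(2)[OF that] width_pos[OF that(1)] by simp
  from GDERIV_white_potential[OF \<Delta> this] show ?thesis
    using profD(13)[OF _ q(2)] by (simp add: q(1))
next
  assume "x \<in> (\<Union>e\<in>{e \<in> dimer_edges B W. white e = \<Delta>}.
        (\<lambda>(q, p). (q, p + (wvert e - bvert e))) ` white_branch D e)"
  then show ?thesis using white_potential_near(2) by (auto simp: white_branch_eq)
qed

end

section \<open>The potential on a neck and its closing points\<close>

context dimer_surgery begin

text \<open>Closing points lie on neither branch and receive the value of r, which agrees there with
  that of s.\<close>

definition neck_potential :: "'n dimer_edge \<Rightarrow> (real^'n) \<times> (real^'n) \<Rightarrow> real" where
  "neck_potential e x = sphi_black D (black e) (fst x) +
     (if x \<in> black_branch D e then s_prof D e (edge_fun D e (fst x)) else r_prof D e (edge_fun D e (fst x)))"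

lemma slope_continuous:
  assumes e: "e \<in> dimer_edges B W" and q: "width D e / 2 < edge_fun D e q"
  shows "isCont (slope (s_prof D e) e) q" "isCont (slope (r_prof D e) e) q"
proof -
  have b: "isCont (grad (sphi_black D (black e))) q" and g: "isCont (grad (edge_fun D e)) q"
    and f: "isCont (edge_fun D e) q"
    using C1_black[OF edge_black[OF e]] C1_f[OF e] C1_imp_continuous_on[OF C1_f[OF e]]
    by (auto simp: C1_def continuous_on_eq_continuous_at)
  have "isCont (deriv (s_prof D e)) (edge_fun D e q)" "isCont (deriv (r_prof D e)) (edge_fun D e q)"
    using profD(11,12)[OF e] q by (auto simp: continuous_on_eq_continuous_at)
  then have c: "isCont (\<lambda>q. deriv (s_prof D e) (edge_fun D e q)) q"
    "isCont (\<lambda>q. deriv (r_prof D e) (edge_fun D e q)) q"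
    using isCont_o2[OF f] by blast+
  show "isCont (slope (s_prof D e) e) q" "isCont (slope (r_prof D e) e) q"
    unfolding slope_def[abs_def] by (intro continuous_add continuous_scaleR b g c)+
qed

lemma neck_sequence:
  assumes e: "e \<in> dimer_edges B W" and x: "x \<in> neck D e"
  obtains X where "\<And>n. fst (X n) \<in> neck_base D e"
    and "\<And>n. snd (X n) = slope (s_prof D e) e (fst (X n)) \<or> snd (X n) = slope (r_prof D e) e (fst (X n))"
    and "X \<longlonglongrightarrow> x"
proof -
  obtain X where X: "\<And>n. X n \<in> black_branch D e \<union> white_branch D e" "X \<longlonglongrightarrow> x"
    using x unfolding neck_def closure_sequential by blast
  have "fst (X n) \<in> neck_base D e \<and>
    (snd (X n) = slope (s_prof D e) e (fst (X n)) \<or> snd (X n) = slope (r_prof D e) e (fst (X n)))" for n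
    using X(1)[of n] by (auto simp: black_branch_eq[OF e] white_branch_eq[OF e])
  then show thesis using that X(2) by blast
qed

lemma edge_fun_tendsto:
  assumes e: "e \<in> dimer_edges B W" and "X \<longlonglongrightarrow> x"
  shows "(\<lambda>n. edge_fun D e (fst (X n))) \<longlonglongrightarrow> edge_fun D e (fst x)"
  using C1_imp_continuous_on[OF C1_f[OF e]] tendsto_fst[OF assms(2)]
  by (auto simp: continuous_on_eq_continuous_at intro: isCont_tendsto_compose)

lemma neck_edge_fun:
  assumes e: "e \<in> dimer_edges B W" and x: "x \<in> neck D e"
  shows "width D e / 2 \<le> edge_fun D e (fst x)" "edge_fun D e (fst x) < width D e"
proof -
  obtain X where X: "\<And>n. fst (X n) \<in> neck_base D e" "X \<longlonglongrightarrow> x"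
    using neck_sequence[OF e x] by metis
  show "width D e / 2 \<le> edge_fun D e (fst x)"
    by (rule LIMSEQ_le_const[OF edge_fun_tendsto[OF e X(2)]])
       (use X(1) in \<open>auto simp: neck_base_def less_imp_le\<close>)
  show "edge_fun D e (fst x) < width D e" using x by (simp add: neck_def)
qed

lemma neck_interior:
  assumes e: "e \<in> dimer_edges B W" and x: "x \<in> neck D e" and w: "width D e / 2 < edge_fun D e (fst x)"
  shows "x \<in> black_branch D e \<or> x \<in> white_branch D e"
proof -
  obtain X where X: "\<And>n. fst (X n) \<in> neck_base D e"
    "\<And>n. snd (X n) = slope (s_prof D e) e (fst (X n)) \<or> snd (X n) = slope (r_prof D e) e (fst (X n))"
    "X \<longlonglongrightarrow> x"
    using neck_sequence[OF e x] by metis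
  \<comment> \<open>The product of the distances to the two slopes vanishes on both branches and is
    continuous; it replaces passing to a subsequence within one branch.\<close>
  let ?z = "\<lambda>x. norm (snd x - slope (s_prof D e) e (fst x)) * norm (snd x - slope (r_prof D e) e (fst x))"
  have "(\<lambda>n. ?z (X n)) \<longlonglongrightarrow> ?z x"
    by (intro tendsto_intros X(3) isCont_tendsto_compose[OF slope_continuous(1)[OF e w]]
        isCont_tendsto_compose[OF slope_continuous(2)[OF e w]])
  moreover have "?z (X n) = 0" for n using X(2)[of n] by auto
  ultimately have "?z x = 0" by (simp add: LIMSEQ_const_iff)
  then have "snd x = slope (s_prof D e) e (fst x) \<or> snd x = slope (r_prof D e) e (fst x)" by simp
  moreover have "fst x \<in> neck_base D e" using w neck_edge_fun[OF e x] by (simp add: neck_base_def)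
  ultimately show ?thesis
    unfolding black_branch_eq[OF e] white_branch_eq[OF e] image_iff by (metis prod.collapse)
qed

text \<open>Both profile slopes tend to \<open>y0 e\<close>, so the limiting covector does not
  depend on which branch the approximating points belong to.\<close>

lemma neck_boundary:
  assumes e: "e \<in> dimer_edges B W" and x: "x \<in> neck D e" and w: "edge_fun D e (fst x) = width D e / 2"
  shows "snd x = grad (sphi_black D (black e)) (fst x) + y0 e *\<^sub>R grad (edge_fun D e) (fst x)"
proof -
  obtain X where X: "\<And>n. fst (X n) \<in> neck_base D e"
    "\<And>n. snd (X n) = slope (s_prof D e) e (fst (X n)) \<or> snd (X n) = slope (r_prof D e) e (fst (X n))"
    "X \<longlonglongrightarrow> x"
    using neck_sequence[OF e x] by metis
  let ?t = "\<lambda>n. edge_fun D e (fst (X n))"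
  let ?b = "grad (sphi_black D (black e))" and ?g = "grad (edge_fun D e)"
  have "width D e / 2 < ?t n" for n using X(1)[of n] by (simp add: neck_base_def)
  then have "\<forall>n. ?t n \<in> {width D e / 2<..} \<and> ?t n \<noteq> width D e / 2" by (simp add: less_imp_neq[symmetric])
  then have "filterlim ?t (at_right (width D e / 2)) sequentially"
    unfolding filterlim_at using edge_fun_tendsto[OF e X(3)] unfolding w
    by (intro conjI[OF always_eventually])
  then have s: "(\<lambda>n. deriv (s_prof D e) (?t n)) \<longlonglongrightarrow> y0 e" and r: "(\<lambda>n. deriv (r_prof D e) (?t n)) \<longlonglongrightarrow> y0 e"
    using filterlim_compose[OF profD(5)[OF e]] filterlim_compose[OF profD(4)[OF e]] by blast+
  have bg: "isCont ?b (fst x)" "isCont ?g (fst x)"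
    using C1_black[OF edge_black[OF e]] C1_f[OF e] by (auto simp: C1_def continuous_on_eq_continuous_at)
  have b: "(\<lambda>n. ?b (fst (X n))) \<longlonglongrightarrow> ?b (fst x)" and g: "(\<lambda>n. ?g (fst (X n))) \<longlonglongrightarrow> ?g (fst x)"
    using isCont_tendsto_compose[OF bg(1) tendsto_fst[OF X(3)]]
      isCont_tendsto_compose[OF bg(2) tendsto_fst[OF X(3)]] .
  let ?E = "\<lambda>n. snd (X n) - ?b (fst (X n)) - y0 e *\<^sub>R ?g (fst (X n))"
  \<comment> \<open>The majorant adds the errors of both profiles, so it works even for a sequence
    alternating between the branches.\<close>
  let ?M = "\<lambda>n. (\<bar>deriv (s_prof D e) (?t n) - y0 e\<bar> + \<bar>deriv (r_prof D e) (?t n) - y0 e\<bar>) * norm (?g (fst (X n)))"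
  have "?M \<longlonglongrightarrow> (\<bar>y0 e - y0 e\<bar> + \<bar>y0 e - y0 e\<bar>) * norm (?g (fst x))"
    by (intro tendsto_intros s r g)
  then have M: "?M \<longlonglongrightarrow> 0" by simp
  have "norm (?E n) \<le> ?M n" for n
  proof -
    have "?E n = (deriv (s_prof D e) (?t n) - y0 e) *\<^sub>R ?g (fst (X n))
        \<or> ?E n = (deriv (r_prof D e) (?t n) - y0 e) *\<^sub>R ?g (fst (X n))"
      using X(2)[of n] by (auto simp: slope_def scaleR_diff_left)
    then show ?thesis by (auto intro!: mult_right_mono)
  qed
  then have "?E \<longlonglongrightarrow> 0"
    by (intro Lim_null_comparison[OF always_eventually M] allI)
  moreover have "?E \<longlonglongrightarrow> snd x - ?b (fst x) - y0 e *\<^sub>R ?g (fst x)"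
    by (intro tendsto_intros X(3) b g)
  ultimately have "snd x - ?b (fst x) - y0 e *\<^sub>R ?g (fst x) = 0"
    using LIMSEQ_unique by blast
  then show ?thesis by (simp add: algebra_simps)
qed

text \<open>A one-sided derivative of the profile suffices because \<open>edge_fun\<close> maps L
  into the half-line. This covers closing points, where the profiles end.\<close>

lemma branch_derivative:
  assumes e: "e \<in> dimer_edges B W"
    and h: "(h has_real_derivative c) (at (edge_fun D e (fst x)) within {width D e / 2..})"
    and L: "L \<subseteq> {x. width D e / 2 \<le> edge_fun D e (fst x)}"
  shows "((\<lambda>x. sphi_black D (black e) (fst x) + h (edge_fun D e (fst x))) has_derivative
    (\<lambda>v. fst v \<bullet> (grad (sphi_black D (black e)) (fst x) + c *\<^sub>R grad (edge_fun D e) (fst x)))) (at x within L)"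
proof -
  have fst: "(fst has_derivative fst) (at x within L)"
    by (rule bounded_linear_imp_has_derivative[OF bounded_linear_fst])
  have b: "((\<lambda>x. sphi_black D (black e) (fst x)) has_derivative
      (\<lambda>v. fst v \<bullet> grad (sphi_black D (black e)) (fst x))) (at x within L)"
    using C1_black[OF edge_black[OF e]] unfolding C1_def gderiv_def
    by (intro has_derivative_compose[OF fst]) blast
  have f: "((\<lambda>x. edge_fun D e (fst x)) has_derivative (\<lambda>v. fst v \<bullet> grad (edge_fun D e) (fst x))) (at x within L)"
    using C1_f[OF e] unfolding C1_def gderiv_def
    by (intro has_derivative_compose[OF fst]) blast
  have "(h has_derivative (*) c) (at (edge_fun D e (fst x)) within (\<lambda>x. edge_fun D e (fst x)) ` L)"
    by (rule has_derivative_subset[OF h[unfolded has_field_derivative_def]]) (use L in auto)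
  from has_derivative_add[OF b has_derivative_in_compose[OF f this]] show ?thesis
    by (simp add: inner_add_right)
qed

text \<open>The slopes differ by a multiple of the gradient of \<open>edge_fun\<close>; the gradient
  is nonzero by convexity and the factor because the arcs of the profile stay apart.\<close>

lemma branches_disjoint:
  assumes e: "e \<in> dimer_edges B W" and q: "q \<in> neck_base D e"
  shows "slope (s_prof D e) e q \<noteq> slope (r_prof D e) e q"
proof -
  have w: "width D e / 2 < edge_fun D e q" using q by (simp add: neck_base_def)
  then have "grad (edge_fun D e) q \<noteq> 0"
    using grad_edge_fun_nonzero[OF dd e kernel, of q] width_pos[OF e] by simp
  moreover have "deriv (s_prof D e) (edge_fun D e q) \<noteq> deriv (r_prof D e) (edge_fun D e q)"
    using profD(8)[OF e w] by simp
  ultimately show ?thesis by (simp add: slope_def)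
qed

lemma white_not_black:
  assumes "e \<in> dimer_edges B W" "x \<in> white_branch D e"
  shows "x \<notin> black_branch D e"
  using assms not_sym[OF branches_disjoint[OF assms(1)]] by (auto simp: black_branch_eq white_branch_eq)

text \<open>Nearby points of the neck stay at positive distance from the other slope.\<close>

lemma eventually_same_branch:
  assumes e: "e \<in> dimer_edges B W" and w: "width D e / 2 < edge_fun D e (fst x)"
    and hk: "h = s_prof D e \<and> k = r_prof D e \<or> h = r_prof D e \<and> k = s_prof D e"
    and x: "snd x = slope h e (fst x)" "snd x \<noteq> slope k e (fst x)"
  shows "eventually (\<lambda>z. z \<in> neck D e \<longrightarrow> snd z = slope h e (fst z) \<and> snd z \<noteq> slope k e (fst z) \<and>
    fst z \<in> neck_base D e) (nhds x)"
proof -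
  have c: "isCont (slope h e) (fst x)" "isCont (slope k e) (fst x)"
    using slope_continuous[OF e w] hk by auto
  have fx: "(fst \<longlongrightarrow> fst x) (nhds x)" and sx: "(snd \<longlongrightarrow> snd x) (nhds x)"
    by (auto simp: tendsto_fst[OF filterlim_ident] tendsto_snd[OF filterlim_ident])
  have fc: "isCont (edge_fun D e) (fst x)"
    using C1_imp_continuous_on[OF C1_f[OF e]] by (simp add: continuous_on_eq_continuous_at)
  have "((\<lambda>z. norm (snd z - slope k e (fst z))) \<longlongrightarrow> norm (snd x - slope k e (fst x))) (nhds x)"
    by (intro tendsto_intros sx isCont_tendsto_compose[OF c(2) fx])
  then have "eventually (\<lambda>z. 0 < norm (snd z - slope k e (fst z))) (nhds x)"
    by (rule order_tendstoD) (use x(2) in simp)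
  moreover have "eventually (\<lambda>z. width D e / 2 < edge_fun D e (fst z)) (nhds x)"
    by (rule order_tendstoD(1)[OF isCont_tendsto_compose[OF fc fx] w])
  ultimately show ?thesis
  proof eventually_elim
    case (elim z)
    show ?case
    proof
      assume z: "z \<in> neck D e"
      then have "fst z \<in> neck_base D e"
        using neck_edge_fun[OF e z] elim(2) by (simp add: neck_base_def)
      moreover have "snd z \<noteq> slope k e (fst z)" using elim(1) by auto
      moreover have "snd z = slope h e (fst z)"
        using neck_interior[OF e z elim(2)] hk \<open>snd z \<noteq> _\<close>
        by (auto simp: black_branch_eq[OF e] white_branch_eq[OF e])
      ultimately show "snd z = slope h e (fst z) \<and> snd z \<noteq> slope k e (fst z) \<and> fst z \<in> neck_base D e"
        by blast
    qed
  qed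
qed

text \<open>Near x the neck consists of the branch of x alone, so the case distinction in
  \<open>neck_potential\<close> is locally constant and the formula for one branch can be
  differentiated.\<close>

lemma neck_potential_interior:
  assumes e: "e \<in> dimer_edges B W" and x: "x \<in> neck D e" and q: "fst x \<in> neck_base D e"
    and hk: "h = s_prof D e \<and> k = r_prof D e \<or> h = r_prof D e \<and> k = s_prof D e"
    and sx: "snd x = slope h e (fst x)"
  shows "(neck_potential e has_derivative (\<lambda>v. fst v \<bullet> snd x)) (at x within neck D e)"
proof -
  have w: "width D e / 2 < edge_fun D e (fst x)" using q by (simp add: neck_base_def)
  let ?\<Psi> = "\<lambda>x. sphi_black D (black e) (fst x) + h (edge_fun D e (fst x))"
  have h: "(h has_real_derivative deriv h (edge_fun D e (fst x))) (at (edge_fun D e (fst x)) within {width D e / 2..})"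
    using hk profD(9,10)[OF e w] by (auto intro: has_field_derivative_at_within)
  have "neck D e \<subseteq> {x. width D e / 2 \<le> edge_fun D e (fst x)}"
    using neck_edge_fun[OF e] by blast
  from branch_derivative[OF e h this]
  have d: "(?\<Psi> has_derivative (\<lambda>v. fst v \<bullet> snd x)) (at x within neck D e)"
    by (simp add: sx slope_def)
  have nx: "snd x \<noteq> slope k e (fst x)"
    using branches_disjoint[OF e q] sx hk by auto
  have eq: "neck_potential e z = ?\<Psi> z"
    if "fst z \<in> neck_base D e" "snd z = slope h e (fst z)" "snd z \<noteq> slope k e (fst z)" for z
  proof -
    have "z \<in> black_branch D e \<longleftrightarrow> snd z = slope (s_prof D e) e (fst z)"
      using that(1) unfolding black_branch_eq[OF e] image_iff by (metis fst_conv snd_conv prod.collapse)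
    then show ?thesis using hk that by (auto simp: neck_potential_def)
  qed
  have "eventually (\<lambda>z. z \<in> neck D e \<longrightarrow> ?\<Psi> z = neck_potential e z) (nhds x)"
    using eventually_same_branch[OF e w hk sx nx] by eventually_elim (auto intro: eq[symmetric])
  then have "eventually (\<lambda>z. ?\<Psi> z = neck_potential e z) (at x within neck D e)"
    unfolding eventually_at_filter by eventually_elim simp
  then show ?thesis
    by (rule has_derivative_transform_eventually[OF d]) (use eq[OF q sx nx] x in simp_all)
qed

lemma neck_potential_derivative:
  assumes e: "e \<in> dimer_edges B W" and x: "x \<in> neck D e"
  shows "(neck_potential e has_derivative (\<lambda>v. fst v \<bullet> snd x)) (at x within neck D e)"
proof (cases "width D e / 2 < edge_fun D e (fst x)")
  case True
  then have q: "fst x \<in> neck_base D e" using neck_edge_fun[OF e x] by (simp add: neck_base_def)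
  have "snd x = slope (s_prof D e) e (fst x) \<or> snd x = slope (r_prof D e) e (fst x)"
    using neck_interior[OF e x True] by (auto simp: black_branch_eq[OF e] white_branch_eq[OF e])
  then show ?thesis
    using neck_potential_interior[OF e x q] by blast
next
  case False
  then have w: "edge_fun D e (fst x) = width D e / 2" using neck_edge_fun[OF e x] by simp
  let ?\<Psi> = "\<lambda>h x. sphi_black D (black e) (fst x) + h (edge_fun D e (fst x))"
  have L: "neck D e \<subseteq> {x. width D e / 2 \<le> edge_fun D e (fst x)}"
    using neck_edge_fun[OF e] by blast
  have "(?\<Psi> h has_derivative (\<lambda>v. fst v \<bullet> snd x)) (at x within neck D e)"
    if "h = s_prof D e \<or> h = r_prof D e" for h
  proof -
    have "(h has_real_derivative y0 e) (at (edge_fun D e (fst x)) within {width D e / 2..})"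
      using that profD(6,7)[OF e] unfolding w by auto
    from branch_derivative[OF e this L] show ?thesis by (simp add: neck_boundary[OF e x w])
  qed
  moreover have "?\<Psi> (s_prof D e) x = ?\<Psi> (r_prof D e) x" using profD(3)[OF e] by (simp only: w)
  \<comment> \<open>At a closing point the two formulas share value and derivative, so they may be
    mixed although both branches accumulate there.\<close>
  ultimately have "((\<lambda>z. if z \<in> black_branch D e then ?\<Psi> (s_prof D e) z else ?\<Psi> (r_prof D e) z)
      has_derivative (\<lambda>v. fst v \<bullet> snd x)) (at x within neck D e)"
    by (intro has_derivative_either) auto
  moreover have "neck_potential e =
      (\<lambda>z. if z \<in> black_branch D e then ?\<Psi> (s_prof D e) z else ?\<Psi> (r_prof D e) z)"
    by (auto simp: neck_potential_def fun_eq_iff)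
  ultimately show ?thesis by simp
qed

text \<open>Over the base of the neck the unmodified part of the sheet is absent and disjointness
  excludes the other necks, so only the branch of e remains.\<close>

lemma glued_black:
  assumes e: "e \<in> dimer_edges B W" and x: "x \<in> black_sheet B W D (black e)" and y: "y \<in> black_branch D e"
    and xy: "fst x = fst y"
  shows "x = y"
proof -
  from y have q: "fst x \<in> neck_base D e" using xy by (auto simp: black_branch_eq[OF e])
  then have lt: "edge_fun D e (fst x) < width D e" by (simp add: neck_base_def)
  from x e lt obtain e' where e': "e' \<in> dimer_edges B W" "black e' = black e" "x \<in> black_branch D e'"
    unfolding black_sheet_def by force
  have "fst x \<in> neck_base D e'" using e' by (auto simp: black_branch_eq)
  then have "e' = e"
    using far_from_others[OF e e'(1), of "fst x"] e'(2) lt by (force simp: neck_base_def)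
  then show ?thesis using e'(3) y xy by (auto simp: black_branch_eq[OF e])
qed

text \<open>The same uniqueness holds as for black sheets, up to the lattice vector that separates
  the two lifts.\<close>

lemma glued_white:
  assumes e: "e \<in> dimer_edges B W" and x: "x \<in> white_sheet B W D (white e)" and y: "y \<in> white_branch D e"
    and xy: "fst x = fst y"
  shows "x = (fst y, snd y + (wvert e - bvert e))"
proof -
  from y have q: "fst x \<in> neck_base D e" using xy by (auto simp: white_branch_eq[OF e])
  then have lt: "edge_fun D e (fst x) < width D e" by (simp add: neck_base_def)
  from x e lt obtain e' z where e': "e' \<in> dimer_edges B W" "white e' = white e" "z \<in> white_branch D e'"
    "x = (fst z, snd z + (wvert e' - bvert e'))"
    unfolding white_sheet_def by force
  have "fst x \<in> neck_base D e'" using e' by (auto simp: white_branch_eq)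
  then have "e' = e"
    using far_from_others[OF e e'(1), of "fst x"] e'(2) lt by (force simp: neck_base_def)
  then show ?thesis using e'(3,4) y xy by (auto simp: white_branch_eq[OF e])
qed

lemma exact: "exact_lagrangian (dimer_lagrangian B W D)"
proof -
  \<comment> \<open>The term \<open>s_prof D e (width D e)\<close> undoes the normalisation in
    \<open>black_potential\<close>, so neck and black primitives agree; C shifts both against the
    white ones.\<close>
  define F :: "'n label \<Rightarrow> (real^'n) \<times> (real^'n) \<Rightarrow> real" where
    "F = (\<lambda>i x. case i of
        Black \<Delta> \<Rightarrow> fst x \<bullet> snd x - black_potential \<Delta> (fst x) + C
      | White \<Delta> \<Rightarrow> fst x \<bullet> snd x - white_potential \<Delta> (fst x) + 0
      | Neck e \<Rightarrow> fst x \<bullet> snd x - neck_potential e x + (s_prof D e (width D e) + C))"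
  have "(F i has_derivative eta x) (at x within patch (dimer_lagrangian B W D) i)"
    if i: "i \<in> patches (dimer_lagrangian B W D)" and x: "x \<in> patch (dimer_lagrangian B W D) i" for i x
  proof (cases i)
    case (Black \<Delta>)
    then have "\<Delta> \<in> B" "x \<in> black_sheet B W D \<Delta>" using i x by (auto simp: dimer_lagrangian_def)
    then show ?thesis
      unfolding F_def Black using legendre_gderiv[OF black_sheet_gderiv] by simp
  next
    case (White \<Delta>)
    then have "\<Delta> \<in> W" "x \<in> white_sheet B W D \<Delta>" using i x by (auto simp: dimer_lagrangian_def)
    then show ?thesis
      unfolding F_def White using legendre_gderiv[OF white_sheet_gderiv, of \<Delta> x 0] by simp
  next
    case (Neck e)
    then have e: "e \<in> dimer_edges B W" "x \<in> neck D e" using i x by (auto simp: dimer_lagrangian_def)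
    have "patch (dimer_lagrangian B W D) (Neck e) = neck D e" by (simp add: dimer_lagrangian_def)
    then show ?thesis
      unfolding F_def Neck using legendre_within[OF neck_potential_derivative[OF e]] by simp
  qed
  moreover have "F i x = F j y" if g: "((i, x), (j, y)) \<in> gluing (dimer_lagrangian B W D)" for i x j y
  proof -
    have "\<exists>e. e \<in> dimer_edges B W \<and> j = Neck e \<and> covering x = covering y \<and>
      (i = Black (black e) \<and> x \<in> black_sheet B W D (black e) \<and> y \<in> black_branch D e \<or>
       i = White (white e) \<and> x \<in> white_sheet B W D (white e) \<and> y \<in> white_branch D e)"
      using g by (auto simp: dimer_lagrangian_def)
    then obtain e where e: "e \<in> dimer_edges B W" and j: "j = Neck e" and c: "covering x = covering y"
      and or: "i = Black (black e) \<and> x \<in> black_sheet B W D (black e) \<and> y \<in> black_branch D e \<or>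
        i = White (white e) \<and> x \<in> white_sheet B W D (white e) \<and> y \<in> white_branch D e"
      by blast
    note xy = covering_eq_imp_fst_eq[OF c]
    from or show ?thesis
    proof (elim disjE conjE)
      assume i: "i = Black (black e)" and x: "x \<in> black_sheet B W D (black e)" and y: "y \<in> black_branch D e"
      have "fst y \<in> neck_base D e" using y by (auto simp: black_branch_eq[OF e])
      from black_potential_near(1)[OF e this] show ?thesis
        unfolding i j F_def glued_black[OF e x y xy] by (simp add: neck_potential_def y)
    next
      assume i: "i = White (white e)" and x: "x \<in> white_sheet B W D (white e)" and y: "y \<in> white_branch D e"
      have q: "fst y \<in> neck_base D e" using y by (auto simp: white_branch_eq[OF e])
      \<comment> \<open>The change of lift cancels the linear part of \<open>sphi_white_eq\<close>.
        What remains is an equation between constants, namely the area condition r \<epsilon> - s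
        \<epsilon> = \<epsilon> + C - f 0 for the profile of e.\<close>
      show ?thesis
        unfolding i j F_def glued_white[OF e x y xy]
        using white_potential_near(1)[OF e q] sphi_white_eq[of D e "fst y"] profD(2)[OF e]
          white_not_black[OF e y]
        by (simp add: neck_potential_def inner_add_right inner_commute)
    qed
  qed
  ultimately show ?thesis unfolding exact_lagrangian_def by blast
qed

end

section \<open>Choice of the kernel, widths and profiles\<close>

lemma finite_positive_lower_bound:
  fixes d :: "'a \<Rightarrow> real"
  assumes "finite A" "\<And>a. a \<in> A \<Longrightarrow> 0 < d a"
  obtains \<epsilon> where "0 < \<epsilon>" "\<And>a. a \<in> A \<Longrightarrow> \<epsilon> < d a"
proof -
  define m where "m = Min (insert 1 (d ` A))"
  have "0 < m" using assms by (simp add: m_def)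
  moreover have "m / 2 < d a" if "a \<in> A" for a
  proof -
    have "m \<le> d a" unfolding m_def using assms(1) that by (intro Min_le) auto
    then show ?thesis using \<open>0 < m\<close> by simp
  qed
  ultimately show thesis using that[of "m / 2"] by simp
qed

theorem corollary3p1p10:
  fixes B W :: "(real^'n) set set"
  assumes "dual_dimer B W"
  shows "\<exists>D. surgery_data B W D \<and> exact_lagrangian (dimer_lagrangian B W D)"
proof -
  let ?E = "dimer_edges B W"
  have fin: "finite ?E" by (rule finite_dimer_edges[OF assms])
  obtain \<rho> :: "real^'n \<Rightarrow> real" where \<rho>: "smoothing_kernel 1 \<rho>" "\<And>y. \<rho> (- y) = \<rho> y"
    using even_smoothing_kernel_exists by blast
  \<comment> \<open>This expression involves only the kernel, so the edge functions are fixed before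
    widths and profiles are chosen in terms of them.\<close>
  define f where "f = (\<lambda>e q. LINT y|lborel. vertex_gap e (q - y) * \<rho> y)"
  have f: "edge_fun D e q = f e q" if "kernel D = \<rho>" "radius D = 1" "e \<in> ?E" for D e q
    using edge_fun_eq_convolution[OF assms that(3), of D q] \<rho>(1) that by (simp add: f_def)
  define A where "A = {(e, e') \<in> ?E \<times> ?E. e \<noteq> e' \<and> (black e = black e' \<or> white e = white e')}"
  have "\<exists>d. \<forall>a\<in>A. 0 < d a \<and> (\<forall>q. d a \<le> f (fst a) q + f (snd a) q)"
  proof (rule bchoice, safe)
    fix e e' assume "(e, e') \<in> A"
    then have e: "e \<in> ?E" "e' \<in> ?E" "e \<noteq> e'" "black e = black e' \<or> white e = white e'"
      by (auto simp: A_def)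
    \<comment> \<open>Placeholder data carrying the right kernel and radius, used to obtain the
      separation bounds in advance.\<close>
    let ?D = "\<lparr>kernel = \<rho>, radius = 1, width = \<lambda>_. 0, r_prof = \<lambda>_ _. 0, s_prof = \<lambda>_ _. 0\<rparr>"
    have "\<exists>\<delta>>0. \<forall>q. \<delta> \<le> edge_fun ?D e q + edge_fun ?D e' q"
      by (rule adjacent_edge_funs_separated[OF assms e]) (use \<rho> in auto)
    then show "\<exists>\<delta>. 0 < \<delta> \<and> (\<forall>q. \<delta> \<le> f (fst (e, e')) q + f (snd (e, e')) q)"
      using f[of ?D] e by simp
  qed
  then obtain d where d: "\<And>a. a \<in> A \<Longrightarrow> 0 < d a" "\<And>a q. a \<in> A \<Longrightarrow> d a \<le> f (fst a) q + f (snd a) q"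
    by blast
  have "finite A" unfolding A_def by (rule finite_subset[OF _ finite_cartesian_product[OF fin fin]]) auto
  then obtain \<mu> where \<mu>: "0 < \<mu>" "\<And>a. a \<in> A \<Longrightarrow> \<mu> < d a"
    using finite_positive_lower_bound[of A d] d(1) by blast
  \<comment> \<open>If two neighbouring edge functions were both at most \<epsilon>, their sum would
    not exceed \<mu>, contradicting the separation bound.\<close>
  define \<epsilon> where "\<epsilon> = \<mu> / 2"
  have \<epsilon>: "0 < \<epsilon>" using \<mu>(1) by (simp add: \<epsilon>_def)
  obtain A0 where A0: "\<And>a. A0 < a \<Longrightarrow> \<exists>r s y. closed_profile a \<epsilon> r s y"
    using closed_profile_exists[OF \<epsilon>] by blast
  \<comment> \<open>With this C every required area \<epsilon> + C - f e 0 is at least A0 + 1,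
    simultaneously for the finitely many edges; the inserted 0 serves an empty graph.\<close>
  define C where "C = A0 - \<epsilon> + Max (insert 0 ((\<lambda>e. f e 0) ` ?E)) + 1"
  have "\<exists>p. \<forall>e\<in>?E. case p e of (r, s, y) \<Rightarrow> closed_profile (\<epsilon> + C - f e 0) \<epsilon> r s y"
  proof (rule bchoice, safe)
    fix e assume "e \<in> ?E"
    then have "f e 0 \<le> Max (insert 0 ((\<lambda>e. f e 0) ` ?E))" using fin by (intro Max_ge) auto
    then have "A0 < \<epsilon> + C - f e 0" by (simp add: C_def)
    then show "\<exists>p. case p of (r, s, y) \<Rightarrow> closed_profile (\<epsilon> + C - f e 0) \<epsilon> r s y"
      using A0 by (metis (mono_tags, lifting) case_prod_conv)
  qed
  then obtain p where p: "\<And>e. e \<in> ?E \<Longrightarrow>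
      closed_profile (\<epsilon> + C - f e 0) \<epsilon> (fst (p e)) (fst (snd (p e))) (snd (snd (p e)))"
    by (auto simp: case_prod_beta)
  define D where "D = \<lparr>kernel = \<rho>, radius = 1, width = \<lambda>_. \<epsilon>, r_prof = \<lambda>e. fst (p e), s_prof = \<lambda>e. fst (snd (p e))\<rparr>"
  have fD: "edge_fun D e q = f e q" if "e \<in> ?E" for e q
    by (rule f) (use that in \<open>simp_all add: D_def\<close>)
  have "{q. edge_fun D e q \<le> width D e} \<inter> {q. edge_fun D e' q \<le> width D e'} = {}"
    if "e \<in> ?E" "e' \<in> ?E" "e \<noteq> e' \<and> (black e = black e' \<or> white e = white e')" for e e'
  proof -
    have "(e, e') \<in> A" using that by (simp add: A_def)
    then have "\<mu> < f e q + f e' q" for q using d(2)[of "(e, e')" q] \<mu>(2)[of "(e, e')"] by simp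
    then have "\<epsilon> < f e q \<or> \<epsilon> < f e' q" for q
      using \<epsilon>_def by (smt (verit) field_sum_of_halves)
    then show ?thesis using fD that(1,2) by (auto simp: D_def not_le[symmetric])
  qed
  moreover have "profile_pair (width D e) (r_prof D e) (s_prof D e)" if "e \<in> ?E" for e
    using p[OF that] by (simp add: D_def closed_profile_def)
  ultimately have sd: "surgery_data B W D"
    unfolding surgery_data_def using \<rho>(1) by (simp add: D_def)
  interpret dimer_surgery B W D C "\<lambda>e. snd (snd (p e))"
    by unfold_locales (use assms sd p fD in \<open>simp_all add: D_def\<close>)
  show ?thesis using sd exact by blast
qed

end
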